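(* Every $H_{mm}$-nest of modular-magic Sudoku boards contains exactly one modular-magic board $B=(B(r,c))_{1\le r,c\le 9}$ satisfying all of the following: $B(1,1)=0$, $B(1,4)=3$, $B(1,7)=6$, $B(2,2)=3$, $B(2,5)=6$, $B(2,8)=0$, $B(3,3)=6$, $B(3,6)=0$, $B(3,9)=3$, $B(4,1)=3$, $B(4,4)=6$, $B(4,7)=0$, $B(5,2)=6$, $B(5,5)=0$, $B(5,8)=3$, $B(6,3)=0$, $B(6,6)=3$, $B(6,9)=6$, $B(7,1)=6$, $B(7,4)=0$, $B(7,7)=3$, $B(8,2)=0$, $B(8,5)=3$, $B(8,8)=6$, $B(9,3)=3$, $B(9,6)=6$, $B(9,9)=0$, and moreover $B(1,3)<B(3,1)$ and $B(4,9)=B(7,6)$.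
   Context: A Sudoku board is a $9\times 9$ array with entries from $\{0,\dots,8\}$, rows indexed $1,\dots,9$ top to bottom and columns $1,\dots,9$ left to right, such that every row, every column, and every $3\times 3$ block (rows $3a+1,\dots,3a+3$, columns $3b+1,\dots,3b+3$) contains each symbol exactly once. Bands are the three horizontal strips of three blocks, pillars the three vertical strips. A modular-magic Sudoku board is a Sudoku board in which, for every block, the entries of each of its three rows, three columns and two diagonals sum to a multiple of $9$. The physical Sudoku symmetry group $H_9$ is the group of rearrangements of the $81$ cells generated by permutations of the bands, permutations of the rows within a band, permutations of the pillars, permutations of the columns within a pillar, and the transpose; it acts on boards by moving entries. $H_{mm}$ is the subgroup of $H_9$ consisting of the elements that map every modular-magic board to a modular-magic board (it has order $4608$). Two modular-magic boards lie in the same $H_{mm}$-nest if one is obtained from the other by an element of $H_{mm}$. *)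

theory Defs
  imports "HOL-Library.FuncSet" "HOL-Combinatorics.Permutations"
begin

definition cells :: "(nat \<times> nat) set" where
  "cells = {1..9} \<times> {1..9}"

type_synonym board = "nat \<times> nat \<Rightarrow> nat"

definition sudoku :: "board \<Rightarrow> bool" where
  "sudoku B \<longleftrightarrow>
     B \<in> cells \<rightarrow>\<^sub>E {0..<9} \<and>
     (\<forall>r\<in>{1..9}. bij_betw (\<lambda>c. B (r, c)) {1..9} {0..<9}) \<and>
     (\<forall>c\<in>{1..9}. bij_betw (\<lambda>r. B (r, c)) {1..9} {0..<9}) \<and>
     (\<forall>a<3. \<forall>b<3. bij_betw B ({3*a+1..3*a+3} \<times> {3*b+1..3*b+3}) {0..<9})"

definition modular_magic :: "board \<Rightarrow> bool" where
  "modular_magic B \<longleftrightarrow> sudoku B \<and>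
     (\<forall>a<3. \<forall>b<3.
        (\<forall>i<3. (\<Sum>j<3. B (3*a+i+1, 3*b+j+1)) mod 9 = 0) \<and>
        (\<forall>j<3. (\<Sum>i<3. B (3*a+i+1, 3*b+j+1)) mod 9 = 0) \<and>
        (\<Sum>i<3. B (3*a+i+1, 3*b+i+1)) mod 9 = 0 \<and>
        (\<Sum>i<3. B (3*a+i+1, 3*b+3-i)) mod 9 = 0)"

definition row_map :: "(nat \<Rightarrow> nat) \<Rightarrow> nat \<times> nat \<Rightarrow> nat \<times> nat" where
  "row_map f = (\<lambda>(r, c). if (r, c) \<in> cells then (f r, c) else (r, c))"

definition col_map :: "(nat \<Rightarrow> nat) \<Rightarrow> nat \<times> nat \<Rightarrow> nat \<times> nat" where
  "col_map f = (\<lambda>(r, c). if (r, c) \<in> cells then (r, f c) else (r, c))"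

definition band_perm :: "(nat \<Rightarrow> nat) \<Rightarrow> nat \<Rightarrow> nat" where
  "band_perm p r = 3 * p ((r - 1) div 3) + (r - 1) mod 3 + 1"

definition within_perm :: "nat \<Rightarrow> (nat \<Rightarrow> nat) \<Rightarrow> nat \<Rightarrow> nat" where
  "within_perm a p r = (if (r - 1) div 3 = a then 3 * a + p ((r - 1) mod 3) + 1 else r)"

definition transpose_cells :: "nat \<times> nat \<Rightarrow> nat \<times> nat" where
  "transpose_cells = (\<lambda>(r, c). if (r, c) \<in> cells then (c, r) else (r, c))"

definition H9_generators :: "(nat \<times> nat \<Rightarrow> nat \<times> nat) set" where
  "H9_generators =
     {row_map (band_perm p) | p. p permutes {0..<3}} \<union>
     {row_map (within_perm a p) | a p. a < 3 \<and> p permutes {0..<3}} \<union>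
     {col_map (band_perm p) | p. p permutes {0..<3}} \<union>
     {col_map (within_perm a p) | a p. a < 3 \<and> p permutes {0..<3}} \<union>
     {transpose_cells}"

text \<open>The group generated (finite, so closure under composition suffices).\<close>
inductive_set H9 :: "(nat \<times> nat \<Rightarrow> nat \<times> nat) set" where
  H9_id: "id \<in> H9"
| H9_step: "g \<in> H9_generators \<Longrightarrow> h \<in> H9 \<Longrightarrow> g \<circ> h \<in> H9"

text \<open>Action on boards by moving entries: the entry at cell x moves to g x.\<close>
definition act :: "(nat \<times> nat \<Rightarrow> nat \<times> nat) \<Rightarrow> board \<Rightarrow> board" where
  "act g B = B \<circ> inv g"

definition Hmm :: "(nat \<times> nat \<Rightarrow> nat \<times> nat) set" where
  "Hmm = {g \<in> H9. \<forall>B. modular_magic B \<longrightarrow> modular_magic (act g B)}"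

definition nest :: "board \<Rightarrow> board set" where
  "nest B = {act g B | g. g \<in> Hmm}"

definition canonical :: "board \<Rightarrow> bool" where
  "canonical B \<longleftrightarrow>
    B (1,1) = 0 \<and> B (1,4) = 3 \<and> B (1,7) = 6 \<and>
    B (2,2) = 3 \<and> B (2,5) = 6 \<and> B (2,8) = 0 \<and>
    B (3,3) = 6 \<and> B (3,6) = 0 \<and> B (3,9) = 3 \<and>
    B (4,1) = 3 \<and> B (4,4) = 6 \<and> B (4,7) = 0 \<and>
    B (5,2) = 6 \<and> B (5,5) = 0 \<and> B (5,8) = 3 \<and>
    B (6,3) = 0 \<and> B (6,6) = 3 \<and> B (6,9) = 6 \<and>
    B (7,1) = 6 \<and> B (7,4) = 0 \<and> B (7,7) = 3 \<and>
    B (8,2) = 0 \<and> B (8,5) = 3 \<and> B (8,8) = 6 \<and>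
    B (9,3) = 3 \<and> B (9,6) = 6 \<and> B (9,9) = 0 \<and>
    B (1,3) < B (3,1) \<and> B (4,9) = B (7,6)"

end

theory Submission
  imports Defs
begin

text \<open>
  Modulo 9 a block is determined by its centre and its two upper corners. The centre is a multiple
  of 3, exactly one diagonal consists of the symbols 0, 3, 6, and the other entries are prime to 3.
  Hence an element of $H_{mm}$ has to move centres of blocks to centres of blocks, and $H_{mm}$
  consists of permutations of bands and pillars, reversals of bands and pillars, and the transpose.

  Existence: the order in which 0, 3, 6 occur on a diagonal, read downwards, is constant along a
  band, and read to the right it is constant along a pillar. Reversals therefore make all these
  diagonals equal to $e-3, e, e+3$ from top left to bottom right, where $e$ is the centre, and
  permuting bands and pillars brings the Latin square of centres into standard form. Every block
  then has one remaining parameter $t$, a unit modulo 9, such that $t^2$ is constant along bands and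
  $(t+3)^2$ is constant along pillars. These two values never agree at a block, so among the three
  possible values either the bands all have one value or the pillars do, and two of the three
  blocks with upper left entry 0 have the same $t$. A shift of bands and pillars moves these two to the
  positions required for $B(4,9)=B(7,6)$, and the transpose settles $B(1,3)<B(3,1)$.

  Uniqueness: an element of $H_{mm}$ between two boards in standard form is a shift by $k$ of the
  bands and by $-k$ of the pillars, up to the transpose. If $k \<noteq> 0$ then $B(4,9)=B(7,6)$ for both boards
  forces $t$ to be constant, so the shift acts trivially.
\<close>

section \<open>Blocks\<close>

definition magic_block :: "(nat \<Rightarrow> nat \<Rightarrow> nat) \<Rightarrow> bool" where
  "magic_block x \<longleftrightarrow>
     (\<forall>i<3. \<forall>j<3. x i j < 9) \<and>
     (\<forall>i<3. \<forall>j<3. \<forall>k<3. \<forall>l<3. x i j = x k l \<longrightarrow> i = k \<and> j = l) \<and>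
     (\<forall>i<3. (x i 0 + x i 1 + x i 2) mod 9 = 0) \<and>
     (\<forall>j<3. (x 0 j + x 1 j + x 2 j) mod 9 = 0) \<and>
     (x 0 0 + x 1 1 + x 2 2) mod 9 = 0 \<and>
     (x 0 2 + x 1 1 + x 2 0) mod 9 = 0"

text \<open>Bands, pillars and positions inside a block are counted from 0, the lines of a board from 1.\<close>

definition entry :: "board \<Rightarrow> nat \<Rightarrow> nat \<Rightarrow> nat \<Rightarrow> nat \<Rightarrow> nat" where
  "entry B a b i j = B (3 * a + i + 1, 3 * b + j + 1)"

lemma All_less_3: "(\<forall>i<3. P i) \<longleftrightarrow> P 0 \<and> P 1 \<and> P (2::nat)"
  by (auto simp: numeral_3_eq_3 numeral_2_eq_2 less_Suc_eq)

lemma line_cases: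
  assumes "r \<in> {1..9::nat}"
  obtains a i where "a < 3" "i < 3" "r = 3 * a + i + 1"
proof
  show "(r - 1) div 3 < 3" "(r - 1) mod 3 < 3" "r = 3 * ((r - 1) div 3) + (r - 1) mod 3 + 1"
    using assms by auto
qed

lemma line_mem: "a < 3 \<Longrightarrow> i < 3 \<Longrightarrow> 3 * a + i + 1 \<in> {1..9::nat}"
  by auto

lemma sum_lessThan_3: "(\<Sum>j<3. f j) = f 0 + f 1 + f (2::nat)"
  by (simp add: numeral_3_eq_3 numeral_2_eq_2)

lemma mod_add_cancel: "(x + i) mod n = (y + i) mod n \<Longrightarrow> x mod n = y mod (n::nat)"
  by (auto simp: nat_mod_eq_iff)

lemma bij_betw_iff_inj_on_card:
  assumes "finite S" "finite T" "card S = card T"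
  shows "bij_betw f S T \<longleftrightarrow> f ` S \<subseteq> T \<and> inj_on f S"
  using assms by (metis bij_betw_def card_image card_subset_eq subset_refl)

lemma ball_band: "(\<forall>x\<in>{3*a+1..3*a+3}. P x) \<longleftrightarrow> (\<forall>i<3. P (3 * a + i + 1))" for a :: nat
proof (intro iffI allI ballI impI)
  fix x assume P: "\<forall>i<3. P (3 * a + i + 1)" and x: "x \<in> {3*a+1..3*a+3}"
  then have "x - 3 * a - 1 < 3" by auto
  with P have "P (3 * a + (x - 3 * a - 1) + 1)" by blast
  moreover have "3 * a + (x - 3 * a - 1) + 1 = x" using x by auto
  ultimately show "P x" by simp
qed auto

text \<open>Each bijectivity condition becomes injectivity, since source and target both have nine
  elements. The bounds on the entries come from the blocks alone, so rows and columns keep only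
  injectivity and the function space keeps only extensionality.\<close>

lemma modular_magic_iff:
  "modular_magic B \<longleftrightarrow>
     B \<in> extensional cells \<and>
     (\<forall>r\<in>{1..9}. inj_on (\<lambda>c. B (r, c)) {1..9}) \<and>
     (\<forall>c\<in>{1..9}. inj_on (\<lambda>r. B (r, c)) {1..9}) \<and>
     (\<forall>a<3. \<forall>b<3. magic_block (entry B a b))"
  (is "_ \<longleftrightarrow> ?E \<and> ?R \<and> ?C \<and> ?M")
proof -
  have blk_iff: "bij_betw B ({3*a+1..3*a+3} \<times> {3*b+1..3*b+3}) {0..<9} \<longleftrightarrow>
      (\<forall>i<3. \<forall>j<3. entry B a b i j < 9) \<and>
      (\<forall>i<3. \<forall>j<3. \<forall>k<3. \<forall>l<3. entry B a b i j = entry B a b k l \<longrightarrow> i = k \<and> j = l)" for a b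
    by (subst bij_betw_iff_inj_on_card)
      (simp_all add: ball_band inj_on_def entry_def image_subset_iff card_cartesian_product
          del: One_nat_def)
  have sums_iff: "(\<forall>i<3. (\<Sum>j<3. B (3*a+i+1, 3*b+j+1)) mod 9 = 0) \<and>
        (\<forall>j<3. (\<Sum>i<3. B (3*a+i+1, 3*b+j+1)) mod 9 = 0) \<and>
        (\<Sum>i<3. B (3*a+i+1, 3*b+i+1)) mod 9 = 0 \<and>
        (\<Sum>i<3. B (3*a+i+1, 3*b+3-i)) mod 9 = 0 \<longleftrightarrow>
     (\<forall>i<3. (entry B a b i 0 + entry B a b i 1 + entry B a b i 2) mod 9 = 0) \<and>
     (\<forall>j<3. (entry B a b 0 j + entry B a b 1 j + entry B a b 2 j) mod 9 = 0) \<and>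
     (entry B a b 0 0 + entry B a b 1 1 + entry B a b 2 2) mod 9 = 0 \<and>
     (entry B a b 0 2 + entry B a b 1 1 + entry B a b 2 0) mod 9 = 0" for a b
  proof -
    have rows: "(\<Sum>j<3. B (3*a+i+1, 3*b+j+1)) = entry B a b i 0 + entry B a b i 1 + entry B a b i 2"
      and cols: "(\<Sum>i<3. B (3*a+i+1, 3*b+j+1)) = entry B a b 0 j + entry B a b 1 j + entry B a b 2 j"
      and diag: "(\<Sum>i<3. B (3*a+i+1, 3*b+i+1)) = entry B a b 0 0 + entry B a b 1 1 + entry B a b 2 2"
      for i j by (simp_all only: sum_lessThan_3 entry_def)
    \<comment> \<open>The subtraction is on natural numbers; its three instances are matched with
      \<open>3*b+j+1\<close> for \<open>j\<close> equal to 2, 1, 0.\<close>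
    have anti: "(\<Sum>i<3. B (3*a+i+1, 3*b+3-i)) = entry B a b 0 2 + entry B a b 1 1 + entry B a b 2 0"
    proof -
      have "3*b+3-0 = 3*b+2+1" "3*b+3-1 = 3*b+1+1" "3*b+3-2 = 3*b+0+1" by simp_all
      then show ?thesis by (simp only: sum_lessThan_3 entry_def)
    qed
    show ?thesis by (simp only: rows cols diag anti)
  qed
  have lines: "(\<forall>r\<in>{1..9}. bij_betw (\<lambda>c. B (r, c)) {1..9} {0..<9}) \<longleftrightarrow> ?R"
    "(\<forall>c\<in>{1..9}. bij_betw (\<lambda>r. B (r, c)) {1..9} {0..<9}) \<longleftrightarrow> ?C"
    if "\<forall>a<3. \<forall>b<3. \<forall>i<3. \<forall>j<3. entry B a b i j < 9"
  proof -
    have lt: "B (r, c) < 9" if rc: "r \<in> {1..9}" "c \<in> {1..9}" for r c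
      using rc(1)
    proof (cases r rule: line_cases)
      case r: (1 a i)
      from rc(2) show ?thesis
      proof (cases c rule: line_cases)
        case (1 b j)
        with r \<open>\<forall>a<3. \<forall>b<3. \<forall>i<3. \<forall>j<3. entry B a b i j < 9\<close> show ?thesis
          by (simp add: entry_def)
      qed
    qed
    show "(\<forall>r\<in>{1..9}. bij_betw (\<lambda>c. B (r, c)) {1..9} {0..<9}) \<longleftrightarrow> ?R"
      "(\<forall>c\<in>{1..9}. bij_betw (\<lambda>r. B (r, c)) {1..9} {0..<9}) \<longleftrightarrow> ?C"
      using lt by (auto simp: bij_betw_iff_inj_on_card image_subset_iff simp del: One_nat_def)
  qed
  have ext: "B \<in> cells \<rightarrow>\<^sub>E {0..<9} \<longleftrightarrow> ?E"
    if lt: "\<forall>a<3. \<forall>b<3. \<forall>i<3. \<forall>j<3. entry B a b i j < 9"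
  proof -
    have "B (r, c) < 9" if rc: "(r, c) \<in> cells" for r c
    proof -
      from rc obtain a i where "a < 3" "i < 3" "r = 3 * a + i + 1"
        using line_cases[of r] by (auto simp: cells_def)
      moreover from rc obtain b j where "b < 3" "j < 3" "c = 3 * b + j + 1"
        using line_cases[of c] by (auto simp: cells_def)
      ultimately show ?thesis using lt by (simp add: entry_def)
    qed
    then show ?thesis by (auto simp: PiE_def)
  qed
  define blk where "blk a b \<longleftrightarrow>
      bij_betw B ({3*a+1..3*a+3} \<times> {3*b+1..3*b+3}) {0..<9}" for a b
  define sums where "sums a b \<longleftrightarrow>
      (\<forall>i<3. (\<Sum>j<3. B (3*a+i+1, 3*b+j+1)) mod 9 = 0) \<and>
      (\<forall>j<3. (\<Sum>i<3. B (3*a+i+1, 3*b+j+1)) mod 9 = 0) \<and>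
      (\<Sum>i<3. B (3*a+i+1, 3*b+i+1)) mod 9 = 0 \<and>
      (\<Sum>i<3. B (3*a+i+1, 3*b+3-i)) mod 9 = 0" for a b
  have "magic_block (entry B a b) \<longleftrightarrow> blk a b \<and> sums a b" for a b
    unfolding blk_def sums_def blk_iff sums_iff magic_block_def by (simp only: conj_assoc)
  then have M: "?M \<longleftrightarrow> (\<forall>a<3. \<forall>b<3. blk a b) \<and> (\<forall>a<3. \<forall>b<3. sums a b)"
    by blast
  have lt: "\<forall>a<3. \<forall>b<3. \<forall>i<3. \<forall>j<3. entry B a b i j < 9" if ?M
    using that by (simp add: magic_block_def)
  show ?thesis
  proof (cases ?M)
    case True
    with M show ?thesis
      unfolding modular_magic_def sudoku_def blk_def[symmetric] sums_def[symmetric]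
        ext[OF lt[OF True]] lines[OF lt[OF True]] by blast
  next
    case False
    with M show ?thesis
      unfolding modular_magic_def sudoku_def blk_def[symmetric] sums_def[symmetric] by blast
  qed
qed

lemma magic_block_transpose: "magic_block x \<Longrightarrow> magic_block (\<lambda>i j. x j i)"
  unfolding magic_block_def by (simp add: ac_simps)

lemma magic_block_flip: "magic_block x \<Longrightarrow> magic_block (\<lambda>i j. x (2 - i) j)"
  unfolding magic_block_def All_less_3 by (simp add: ac_simps)

lemma magic_block_cong:
  assumes "magic_block x" "\<And>i j. i < 3 \<Longrightarrow> j < 3 \<Longrightarrow> x i j = y i j"
  shows "magic_block y"
  using assms(1) unfolding magic_block_def by (simp add: assms(2))

text \<open>The two diagonals and the middle column together cover the first and the last row once
  and the centre three times. So 9 divides three times the centre.\<close>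

lemma magic_block_centre:
  assumes "magic_block x"
  shows "x 1 1 = 0 \<or> x 1 1 = 3 \<or> x 1 1 = 6"
proof -
  have lt: "x 1 1 < 9"
    and d: "9 dvd x 0 0 + x 0 1 + x 0 2" "9 dvd x 2 0 + x 2 1 + x 2 2"
    and d': "9 dvd x 0 0 + x 1 1 + x 2 2" "9 dvd x 0 2 + x 1 1 + x 2 0" "9 dvd x 0 1 + x 1 1 + x 2 1"
    using assms by (simp_all add: magic_block_def All_less_3 dvd_eq_mod_eq_0)
  have
    "9 dvd (x 0 0 + x 1 1 + x 2 2) + (x 0 2 + x 1 1 + x 2 0) + (x 0 1 + x 1 1 + x 2 1)"
    "9 dvd (x 0 0 + x 0 1 + x 0 2) + (x 2 0 + x 2 1 + x 2 2)"
    by (rule dvd_add[OF dvd_add[OF d'(1,2)] d'(3)], rule dvd_add[OF d])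
  moreover have "(x 0 0 + x 1 1 + x 2 2) + (x 0 2 + x 1 1 + x 2 0) + (x 0 1 + x 1 1 + x 2 1) =
      (x 0 0 + x 0 1 + x 0 2) + (x 2 0 + x 2 1 + x 2 2) + 3 * x 1 1"
    by simp
  ultimately have "9 dvd 3 * x 1 1"
    using dvd_add_right_iff by metis
  with lt show ?thesis by presburger
qed

text \<open>Solves a congruence for \<open>x\<close> on natural numbers: \<open>q\<close> is an
  explicit negative of \<open>p'\<close>, and \<open>p'\<close> may be any representative of
  \<open>p\<close>, for instance one with inner reductions removed.\<close>

lemma mod_complement_unique:
  assumes "(p + x) mod n = 0" "(p' + q) mod n = 0" "p mod n = p' mod n" "x < (n::nat)"
  shows "x = q mod n"
proof -
  have "(p' + x) mod n = (p' + q) mod n"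
    using assms by (metis mod_add_left_eq)
  then obtain k l where "p' + x + n * k = p' + q + n * l"
    by (auto simp: nat_mod_eq_iff)
  then have "x + n * k = q + n * l" by simp
  then have "x mod n = q mod n" by (auto simp: nat_mod_eq_iff)
  with assms show ?thesis by simp
qed

text \<open>The lower corners come from the diagonals, the edge entries from the outer rows and
  columns. The summand 18 is a multiple of 9 above every sum of two entries, so no subtraction
  truncates.\<close>

lemma magic_block_entries:
  assumes "magic_block x"
  defines "e \<equiv> x 1 1" and "\<alpha> \<equiv> x 0 0" and "\<beta> \<equiv> x 0 2"
  shows "x 0 1 = (18 - \<alpha> - \<beta>) mod 9"
    "x 1 0 = (18 + e + \<beta> - \<alpha>) mod 9" "x 1 2 = (18 + e + \<alpha> - \<beta>) mod 9"
    "x 2 0 = (18 - e - \<beta>) mod 9" "x 2 1 = (2 * e + \<alpha> + \<beta>) mod 9"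
    "x 2 2 = (18 - e - \<alpha>) mod 9"
proof -
  have eq: "(\<alpha> + \<beta> + x 0 1) mod 9 = 0" "(\<alpha> + e + x 2 2) mod 9 = 0" "(\<beta> + e + x 2 0) mod 9 = 0"
    "(\<alpha> + x 2 0 + x 1 0) mod 9 = 0" "(\<beta> + x 2 2 + x 1 2) mod 9 = 0"
    "(x 2 0 + x 2 2 + x 2 1) mod 9 = 0"
    and lt: "e < 9" "\<alpha> < 9" "\<beta> < 9" "x 0 1 < 9" "x 1 0 < 9" "x 1 2 < 9" "x 2 0 < 9" "x 2 1 < 9" "x 2 2 < 9"
    using assms by (simp_all add: magic_block_def All_less_3 ac_simps)
  show x20: "x 2 0 = (18 - e - \<beta>) mod 9"
    by (rule mod_complement_unique[OF eq(3)]) (use lt in simp_all)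
  show x22: "x 2 2 = (18 - e - \<alpha>) mod 9"
    by (rule mod_complement_unique[OF eq(2)]) (use lt in simp_all)
  show "x 0 1 = (18 - \<alpha> - \<beta>) mod 9"
    by (rule mod_complement_unique[OF eq(1)]) (use lt in simp_all)
  show "x 1 0 = (18 + e + \<beta> - \<alpha>) mod 9"
    by (rule mod_complement_unique[OF eq(4), of "\<alpha> + (18 - e - \<beta>)"]) (use lt in \<open>simp_all add: x20 x22 mod_simps\<close>)
  show "x 1 2 = (18 + e + \<alpha> - \<beta>) mod 9"
    by (rule mod_complement_unique[OF eq(5), of "\<beta> + (18 - e - \<alpha>)"]) (use lt in \<open>simp_all add: x20 x22 mod_simps\<close>)
  have "(x 2 0 + x 2 2) mod 9 = ((18 - e - \<beta>) + (18 - e - \<alpha>)) mod 9"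
    unfolding x20 x22 by (rule mod_add_eq)
  then show "x 2 1 = (2 * e + \<alpha> + \<beta>) mod 9"
    by (rule mod_complement_unique[OF eq(6), rotated]) (use lt in simp_all)
qed

text \<open>The table runs over the centre and the two upper corners, which determine the block.\<close>

lemma magic_block_table:
  "list_all (\<lambda>e. list_all (\<lambda>\<alpha>. list_all (\<lambda>\<beta>.
      distinct [\<alpha>, (18 - \<alpha> - \<beta>) mod 9, \<beta>, (18 + e + \<beta> - \<alpha>) mod 9, e, (18 + e + \<alpha> - \<beta>) mod 9,
        (18 - e - \<beta>) mod 9, (2 * e + \<alpha> + \<beta>) mod 9, (18 - e - \<alpha>) mod 9] \<longrightarrow>
      \<not> 3 dvd (18 - \<alpha> - \<beta>) mod 9 \<and> \<not> 3 dvd (18 + e + \<beta> - \<alpha>) mod 9 \<and>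
      \<not> 3 dvd (18 + e + \<alpha> - \<beta>) mod 9 \<and> \<not> 3 dvd (2 * e + \<alpha> + \<beta>) mod 9 \<and>
      (\<alpha> = (e + 6) mod 9 \<and> (18 - e - \<alpha>) mod 9 = (e + 3) mod 9 \<and> \<not> 3 dvd \<beta> \<and> \<not> 3 dvd (18 - e - \<beta>) mod 9 \<or>
       \<alpha> = (e + 3) mod 9 \<and> (18 - e - \<alpha>) mod 9 = (e + 6) mod 9 \<and> \<not> 3 dvd \<beta> \<and> \<not> 3 dvd (18 - e - \<beta>) mod 9 \<or>
       \<beta> = (e + 6) mod 9 \<and> (18 - e - \<beta>) mod 9 = (e + 3) mod 9 \<and> \<not> 3 dvd \<alpha> \<and> \<not> 3 dvd (18 - e - \<alpha>) mod 9 \<or>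
       \<beta> = (e + 3) mod 9 \<and> (18 - e - \<beta>) mod 9 = (e + 6) mod 9 \<and> \<not> 3 dvd \<alpha> \<and> \<not> 3 dvd (18 - e - \<alpha>) mod 9))
     [0..<9]) [0..<9]) [0::nat, 3, 6]"
  by code_simp

text \<open>Transfers the table to a block. The four disjuncts tell which diagonal consists of
  multiples of 3 and which of its ends carries the centre minus 3, since adding 6 modulo 9 subtracts
  3.\<close>

lemma magic_block_shape:
  assumes "magic_block x"
  shows "x 1 1 \<in> {0, 3, 6}" "\<not> 3 dvd x 0 1" "\<not> 3 dvd x 1 0" "\<not> 3 dvd x 1 2" "\<not> 3 dvd x 2 1"
    "x 0 0 = (x 1 1 + 6) mod 9 \<and> x 2 2 = (x 1 1 + 3) mod 9 \<and> \<not> 3 dvd x 0 2 \<and> \<not> 3 dvd x 2 0 \<or>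
     x 0 0 = (x 1 1 + 3) mod 9 \<and> x 2 2 = (x 1 1 + 6) mod 9 \<and> \<not> 3 dvd x 0 2 \<and> \<not> 3 dvd x 2 0 \<or>
     x 0 2 = (x 1 1 + 6) mod 9 \<and> x 2 0 = (x 1 1 + 3) mod 9 \<and> \<not> 3 dvd x 0 0 \<and> \<not> 3 dvd x 2 2 \<or>
     x 0 2 = (x 1 1 + 3) mod 9 \<and> x 2 0 = (x 1 1 + 6) mod 9 \<and> \<not> 3 dvd x 0 0 \<and> \<not> 3 dvd x 2 2"
proof -
  define e \<alpha> \<beta> where "e = x 1 1" and "\<alpha> = x 0 0" and "\<beta> = x 0 2"
  have mem: "e \<in> set [0, 3, 6]" "\<alpha> \<in> set [0..<9]" "\<beta> \<in> set [0..<9]"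
    using assms magic_block_centre[OF assms] by (simp_all add: magic_block_def e_def \<alpha>_def \<beta>_def)
  have "distinct [x 0 0, x 0 1, x 0 2, x 1 0, x 1 1, x 1 2, x 2 0, x 2 1, x 2 2]"
    using assms unfolding magic_block_def All_less_3 by simp
  \<comment> \<open>The entry formulas rewrite the distinctness of the nine entries into the premise
    of the table; reading them backwards returns the conclusion to the entries.\<close>
  note bspec[OF bspec[OF bspec[OF magic_block_table[unfolded list_all_iff] mem(1)] mem(2)] mem(3),
      THEN mp, OF this[unfolded magic_block_entries[OF assms], folded e_def \<alpha>_def \<beta>_def]]
  note * = this[folded magic_block_entries[OF assms, folded e_def \<alpha>_def \<beta>_def],
      unfolded e_def \<alpha>_def \<beta>_def]
  show "x 1 1 \<in> {0, 3, 6}"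
    using magic_block_centre[OF assms] by simp
  show "\<not> 3 dvd x 0 1" "\<not> 3 dvd x 1 0" "\<not> 3 dvd x 1 2" "\<not> 3 dvd x 2 1"
    "x 0 0 = (x 1 1 + 6) mod 9 \<and> x 2 2 = (x 1 1 + 3) mod 9 \<and> \<not> 3 dvd x 0 2 \<and> \<not> 3 dvd x 2 0 \<or>
     x 0 0 = (x 1 1 + 3) mod 9 \<and> x 2 2 = (x 1 1 + 6) mod 9 \<and> \<not> 3 dvd x 0 2 \<and> \<not> 3 dvd x 2 0 \<or>
     x 0 2 = (x 1 1 + 6) mod 9 \<and> x 2 0 = (x 1 1 + 3) mod 9 \<and> \<not> 3 dvd x 0 0 \<and> \<not> 3 dvd x 2 2 \<or>
     x 0 2 = (x 1 1 + 3) mod 9 \<and> x 2 0 = (x 1 1 + 6) mod 9 \<and> \<not> 3 dvd x 0 0 \<and> \<not> 3 dvd x 2 2"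
    using * by blast+
qed

section \<open>Cell rearrangements\<close>

text \<open>What the row part and the column part of every element of \<open>H9\<close> have in
  common: strips of three lines go to strips. This is stable under composition and inverse.\<close>

definition line_perm :: "(nat \<Rightarrow> nat) \<Rightarrow> bool" where
  "line_perm \<sigma> \<longleftrightarrow> bij_betw \<sigma> {1..9} {1..9} \<and>
     (\<forall>r\<in>{1..9}. \<forall>s\<in>{1..9}. (\<sigma> r - 1) div 3 = (\<sigma> s - 1) div 3 \<longleftrightarrow> (r - 1) div 3 = (s - 1) div 3)"

lemma line_perm_mem: "line_perm \<sigma> \<Longrightarrow> r \<in> {1..9} \<Longrightarrow> \<sigma> r \<in> {1..9}"
  unfolding line_perm_def by (meson bij_betwE)

lemma line_perm_comp:
  assumes "line_perm \<sigma>" "line_perm \<tau>"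
  shows "line_perm (\<sigma> \<circ> \<tau>)"
  using assms bij_betw_trans[of \<tau> "{1..9}" "{1..9}" \<sigma> "{1..9}"] line_perm_mem[OF assms(2)]
  unfolding line_perm_def by (simp add: comp_def)

lemma line_perm_inv_into:
  assumes "line_perm \<sigma>"
  shows "line_perm (inv_into {1..9} \<sigma>)"
proof -
  have bij: "bij_betw \<sigma> {1..9} {1..9}" using assms by (simp add: line_perm_def)
  have inv: "inv_into {1..9} \<sigma> r \<in> {1..9}" "\<sigma> (inv_into {1..9} \<sigma> r) = r" if "r \<in> {1..9}" for r
    using that bij by (metis bij_betw_def inv_into_into) (metis that bij bij_betw_inv_into_right)
  show ?thesis
    unfolding line_perm_def
  proof (intro conjI ballI)
    fix r s :: nat assume rs: "r \<in> {1..9}" "s \<in> {1..9}"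
    have "(\<sigma> t - 1) div 3 = (\<sigma> u - 1) div 3 \<longleftrightarrow> (t - 1) div 3 = (u - 1) div 3"
      if "t \<in> {1..9}" "u \<in> {1..9}" for t u
      using assms that unfolding line_perm_def by blast
    from this[OF inv(1)[OF rs(1)] inv(1)[OF rs(2)]]
    show "(inv_into {1..9} \<sigma> r - 1) div 3 = (inv_into {1..9} \<sigma> s - 1) div 3 \<longleftrightarrow>
        (r - 1) div 3 = (s - 1) div 3"
      unfolding inv(2)[OF rs(1)] inv(2)[OF rs(2)] by blast
  qed (use bij bij_betw_inv_into in blast)
qed

text \<open>A line is split into strip and position: \<open>\<pi>\<close> moves strips,
  \<open>\<phi> a\<close> moves positions within strip \<open>a\<close>. Injectivity follows by
  comparing quotients, then remainders.\<close>

lemma line_permI: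
  assumes f: "\<And>a i. a < 3 \<Longrightarrow> i < 3 \<Longrightarrow> f (3 * a + i + 1) = 3 * \<pi> a + \<phi> a i + 1"
    and \<pi>: "\<And>a. a < 3 \<Longrightarrow> \<pi> a < 3" "inj_on \<pi> {..<3}"
    and \<phi>: "\<And>a i. a < 3 \<Longrightarrow> i < 3 \<Longrightarrow> \<phi> a i < 3" "\<And>a. a < 3 \<Longrightarrow> inj_on (\<phi> a) {..<3}"
  shows "line_perm f"
proof -
  have dm: "(f r - 1) div 3 = \<pi> ((r - 1) div 3) \<and>
      (f r - 1) mod 3 = \<phi> ((r - 1) div 3) ((r - 1) mod 3) \<and> f r \<in> {1..9}"
    if "r \<in> {1..9}" for r
    using that
  proof (cases r rule: line_cases)
    case (1 a i)
    then have eq: "(r - 1) div 3 = a" "(r - 1) mod 3 = i" "f r - 1 = 3 * \<pi> a + \<phi> a i"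
      using f[of a i] by simp_all
    show ?thesis
      unfolding eq using 1 f[of a i] \<pi>(1)[of a] \<phi>(1)[of a i] by auto
  qed
  then have d: "(f r - 1) div 3 = \<pi> ((r - 1) div 3)"
    and m: "(f r - 1) mod 3 = \<phi> ((r - 1) div 3) ((r - 1) mod 3)"
    and mem: "f r \<in> {1..9}" if "r \<in> {1..9}" for r
    using that by blast+
  have lt: "(r - 1) div 3 < 3" if "r \<in> {1..9}" for r :: nat using that by auto
  have "inj_on f {1..9}"
  proof (rule inj_onI)
    fix r s assume rs: "r \<in> {1..9}" "s \<in> {1..9}" "f r = f s"
    then have eq: "(r - 1) div 3 = (s - 1) div 3"
      using d \<pi>(2) lt by (metis inj_onD lessThan_iff)
    moreover have "(r - 1) mod 3 = (s - 1) mod 3"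
      using m[OF rs(1)] m[OF rs(2)] rs(3) eq \<phi>(2)[OF lt[OF rs(1)]]
      by (metis inj_onD lessThan_iff mod_less_divisor zero_less_numeral)
    ultimately have "r - 1 = s - 1" by (metis div_mod_decomp)
    with rs(1,2) show "r = s" by auto
  qed
  then have "bij_betw f {1..9} {1..9}"
    using mem by (subst bij_betw_iff_inj_on_card) auto
  moreover have "(f r - 1) div 3 = (f s - 1) div 3 \<longleftrightarrow> (r - 1) div 3 = (s - 1) div 3"
    if "r \<in> {1..9}" "s \<in> {1..9}" for r s
    using d that \<pi>(2) lt by (metis inj_onD lessThan_iff)
  ultimately show ?thesis by (simp add: line_perm_def)
qed

lemma band_perm_line: "i < 3 \<Longrightarrow> band_perm p (3 * a + i + 1) = 3 * p a + i + 1"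
  by (simp add: band_perm_def)

lemma within_perm_line:
  "i < 3 \<Longrightarrow> within_perm b p (3 * a + i + 1) = 3 * a + (if a = b then p i else i) + 1"
  by (simp add: within_perm_def)

lemma permutes_less_3: "p permutes {0..<3::nat} \<Longrightarrow> a < 3 \<Longrightarrow> p a < 3"
  using permutes_in_image[of p "{0..<3}" a] by simp

lemma line_perm_band_perm: "p permutes {0..<3} \<Longrightarrow> line_perm (band_perm p)"
  by (rule line_permI[where \<pi> = p and \<phi> = "\<lambda>_ i. i"])
    (auto simp: band_perm_line[simplified] permutes_less_3 permutes_inj_on)

lemma line_perm_within_perm: "p permutes {0..<3} \<Longrightarrow> line_perm (within_perm b p)"
  by (rule line_permI[where \<pi> = "\<lambda>a. a" and \<phi> = "\<lambda>a i. if a = b then p i else i"])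
    (auto simp: within_perm_line[simplified] permutes_less_3 inj_on_def dest: permutes_inj[THEN injD])

lemma row_map_permutes:
  assumes "line_perm f"
  shows "row_map f permutes cells"
proof (rule bij_imp_permutes)
  have "bij_betw f {1..9} {1..9}" using assms by (simp add: line_perm_def)
  then have "bij_betw (map_prod f id) cells cells"
    unfolding cells_def by (intro bij_betw_map_prod) simp_all
  then show "bij_betw (row_map f) cells cells"
    by (rule bij_betw_cong[THEN iffD1, rotated]) (auto simp: row_map_def)
qed (auto simp: row_map_def)

lemma transpose_cells_permutes: "transpose_cells permutes cells"
proof (rule bij_imp_permutes)
  show "bij_betw transpose_cells cells cells"
    by (rule bij_betwI[where g = transpose_cells]) (auto simp: transpose_cells_def cells_def)
qed (auto simp: transpose_cells_def)

text \<open>Carries facts on rows to columns. The assumption keeps the intermediate cell on the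
  board, as \<open>transpose_cells\<close> fixes everything outside.\<close>

lemma col_map_eq:
  assumes "\<And>c. c \<in> {1..9} \<Longrightarrow> f c \<in> {1..9}"
  shows "col_map f = transpose_cells \<circ> row_map f \<circ> transpose_cells"
  using assms by (auto simp: fun_eq_iff col_map_def row_map_def transpose_cells_def cells_def)

lemma col_map_permutes:
  assumes "line_perm f"
  shows "col_map f permutes cells"
proof -
  have "col_map f = transpose_cells \<circ> row_map f \<circ> transpose_cells"
    by (rule col_map_eq) (rule line_perm_mem[OF assms])
  then show ?thesis
    by (simp only: permutes_compose transpose_cells_permutes row_map_permutes assms)
qed

lemma H9_generators_cases:
  assumes "g \<in> H9_generators"
  obtains f where "line_perm f" "g = row_map f" | f where "line_perm f" "g = col_map f" | "g = transpose_cells"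
  using assms line_perm_band_perm line_perm_within_perm unfolding H9_generators_def by blast

lemma H9_permutes: "g \<in> H9 \<Longrightarrow> g permutes cells"
proof (induction rule: H9.induct)
  case (H9_step g h)
  from H9_step.hyps(1) have "g permutes cells"
    by (cases rule: H9_generators_cases)
      (auto simp: row_map_permutes col_map_permutes transpose_cells_permutes)
  with H9_step.IH show ?case by (rule permutes_compose)
qed (rule permutes_id)

text \<open>Induction over the generators: a row or column map is composed with whichever of
  \<sigma> and \<tau> currently controls that coordinate, and the transpose exchanges the two
  shapes.\<close>

lemma H9_form:
  assumes "g \<in> H9"
  obtains \<sigma> \<tau> where "line_perm \<sigma>" "line_perm \<tau>"
      "(\<forall>r\<in>{1..9}. \<forall>c\<in>{1..9}. g (r, c) = (\<sigma> r, \<tau> c)) \<or>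
       (\<forall>r\<in>{1..9}. \<forall>c\<in>{1..9}. g (r, c) = (\<tau> c, \<sigma> r))"
proof -
  from assms have "\<exists>\<sigma> \<tau>. line_perm \<sigma> \<and> line_perm \<tau> \<and>
      ((\<forall>r\<in>{1..9}. \<forall>c\<in>{1..9}. g (r, c) = (\<sigma> r, \<tau> c)) \<or>
       (\<forall>r\<in>{1..9}. \<forall>c\<in>{1..9}. g (r, c) = (\<tau> c, \<sigma> r)))"
    (is "\<exists>\<sigma> \<tau>. ?P g \<sigma> \<tau>")
  proof (induction rule: H9.induct)
    case H9_id
    have "line_perm id" by (auto simp: line_perm_def)
    then have "?P id id id" unfolding id_apply by blast
    then show ?case by blast
  next
    case (H9_step g h)
    then obtain \<sigma> \<tau> where h: "?P h \<sigma> \<tau>" by blast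
    then have mem: "\<sigma> r \<in> {1..9}" "\<tau> r \<in> {1..9}" if "r \<in> {1..9}" for r
      using that line_perm_mem by blast+
    from h consider (straight) "\<forall>r\<in>{1..9}. \<forall>c\<in>{1..9}. h (r, c) = (\<sigma> r, \<tau> c)"
      | (swapped) "\<forall>r\<in>{1..9}. \<forall>c\<in>{1..9}. h (r, c) = (\<tau> c, \<sigma> r)" by blast
    note h_cases = this
    from H9_step.hyps(1) show ?case
    proof (cases rule: H9_generators_cases)
      case (1 f)
      then have f: "line_perm (f \<circ> \<sigma>)" "line_perm (f \<circ> \<tau>)" using h line_perm_comp by blast+
      have g: "g (r, c) = (f r, c)" if "r \<in> {1..9}" "c \<in> {1..9}" for r c
        using that 1 by (simp add: row_map_def cells_def)
      show ?thesis
      proof (cases rule: h_cases)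
        case straight
        then have "\<forall>r\<in>{1..9}. \<forall>c\<in>{1..9}. (g \<circ> h) (r, c) = ((f \<circ> \<sigma>) r, \<tau> c)"
          using g mem by simp
        with f h show ?thesis by blast
      next
        case swapped
        then have "\<forall>r\<in>{1..9}. \<forall>c\<in>{1..9}. (g \<circ> h) (r, c) = ((f \<circ> \<tau>) c, \<sigma> r)"
          using g mem by simp
        with f h show ?thesis by blast
      qed
    next
      case (2 f)
      then have f: "line_perm (f \<circ> \<sigma>)" "line_perm (f \<circ> \<tau>)" using h line_perm_comp by blast+
      have g: "g (r, c) = (r, f c)" if "r \<in> {1..9}" "c \<in> {1..9}" for r c
        using that 2 by (simp add: col_map_def cells_def)
      show ?thesis
      proof (cases rule: h_cases)
        case straight
        then have "\<forall>r\<in>{1..9}. \<forall>c\<in>{1..9}. (g \<circ> h) (r, c) = (\<sigma> r, (f \<circ> \<tau>) c)"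
          using g mem by simp
        with f h show ?thesis by blast
      next
        case swapped
        then have "\<forall>r\<in>{1..9}. \<forall>c\<in>{1..9}. (g \<circ> h) (r, c) = (\<tau> c, (f \<circ> \<sigma>) r)"
          using g mem by simp
        with f h show ?thesis by blast
      qed
    next
      case 3
      then have g: "g (r, c) = (c, r)" if "r \<in> {1..9}" "c \<in> {1..9}" for r c
        using that by (simp add: transpose_cells_def cells_def)
      show ?thesis
      proof (cases rule: h_cases)
        case straight
        then have "\<forall>r\<in>{1..9}. \<forall>c\<in>{1..9}. (g \<circ> h) (r, c) = (\<tau> c, \<sigma> r)"
          using g mem by simp
        with h show ?thesis by blast
      next
        case swapped
        then have "\<forall>r\<in>{1..9}. \<forall>c\<in>{1..9}. (g \<circ> h) (r, c) = (\<sigma> r, \<tau> c)"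
          using g mem by simp
        with h show ?thesis by blast
      qed
    qed
  qed
  with that show ?thesis by blast
qed

section \<open>Composition in \<open>H9\<close> and the action on boards\<close>

lemma H9_comp: "g \<in> H9 \<Longrightarrow> h \<in> H9 \<Longrightarrow> g \<circ> h \<in> H9"
  by (induction rule: H9.induct) (auto simp: comp_assoc intro: H9.intros)

lemma H9_generator: "g \<in> H9_generators \<Longrightarrow> g \<in> H9"
  using H9.H9_step[OF _ H9.H9_id] by simp

lemma act_apply: "g permutes cells \<Longrightarrow> act g B (g x) = B x"
  by (simp add: act_def permutes_inverses)

lemma act_comp:
  assumes "g permutes cells" "h permutes cells"
  shows "act (g \<circ> h) B = act g (act h B)"
  using assms by (simp add: act_def o_inv_distrib permutes_bij comp_assoc)

lemma act_extensional:
  assumes "g permutes cells" "B \<in> extensional cells"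
  shows "act g B \<in> extensional cells"
  using assms permutes_not_in[OF permutes_inv[OF assms(1)]]
  by (auto simp: act_def extensional_def)

lemma Hmm_permutes: "g \<in> Hmm \<Longrightarrow> g permutes cells"
  by (simp add: Hmm_def H9_permutes)

lemma Hmm_comp: "g \<in> Hmm \<Longrightarrow> h \<in> Hmm \<Longrightarrow> g \<circ> h \<in> Hmm"
  using H9_permutes by (auto simp: Hmm_def H9_comp act_comp)

section \<open>Rearrangements that preserve modular-magic boards\<close>

lemma modular_magic_transpose:
  assumes B: "modular_magic B" and ext: "B' \<in> extensional cells"
    and eq: "\<And>r c. r \<in> {1..9} \<Longrightarrow> c \<in> {1..9} \<Longrightarrow> B' (r, c) = B (c, r)"
  shows "modular_magic B'"
  unfolding modular_magic_iff
proof (intro conjI allI impI ballI)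
  fix r :: nat assume "r \<in> {1..9}"
  with B show "inj_on (\<lambda>c. B' (r, c)) {1..9}" "inj_on (\<lambda>c. B' (c, r)) {1..9}"
    unfolding modular_magic_iff by (auto simp: eq inj_on_def)
next
  fix a b :: nat assume ab: "a < 3" "b < 3"
  with B have "magic_block (entry B b a)" by (simp add: modular_magic_iff)
  from magic_block_transpose[OF this] show "magic_block (entry B' a b)"
    by (rule magic_block_cong) (use ab in \<open>simp add: entry_def eq\<close>)
qed (fact ext)

text \<open>\<open>f\<close> tells from which row a new row is read, so it is the inverse of the
  movement. Reversing a band exchanges the two diagonals of its blocks and only permutes the eight
  sums.\<close>

lemma modular_magic_rearrange_rows:
  assumes B: "modular_magic B" and ext: "B' \<in> extensional cells"
    and f: "line_perm f"
    and eq: "\<And>r c. r \<in> {1..9} \<Longrightarrow> c \<in> {1..9} \<Longrightarrow> B' (r, c) = B (f r, c)"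
    and rev: "\<And>a. a < 3 \<Longrightarrow> \<exists>a'<3. (\<forall>i<3. f (3 * a + i + 1) = 3 * a' + i + 1) \<or>
                (\<forall>i<3. f (3 * a + i + 1) = 3 * a' + (2 - i) + 1)"
  shows "modular_magic B'"
  unfolding modular_magic_iff
proof (intro conjI allI impI ballI)
  fix r :: nat assume r: "r \<in> {1..9}"
  show "inj_on (\<lambda>c. B' (r, c)) {1..9}"
    using B r line_perm_mem[OF f r] unfolding modular_magic_iff by (auto simp: eq inj_on_def)
next
  fix c :: nat assume c: "c \<in> {1..9}"
  have "inj_on ((\<lambda>r. B (r, c)) \<circ> f) {1..9}"
    using B c f unfolding modular_magic_iff line_perm_def bij_betw_def by (auto intro!: comp_inj_on)
  then show "inj_on (\<lambda>r. B' (r, c)) {1..9}"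
    using c by (simp add: inj_on_def eq)
next
  fix a b :: nat assume ab: "a < 3" "b < 3"
  from rev[OF ab(1)] obtain a' where a': "a' < 3" "(\<forall>i<3. f (3 * a + i + 1) = 3 * a' + i + 1) \<or>
      (\<forall>i<3. f (3 * a + i + 1) = 3 * a' + (2 - i) + 1)" by blast
  with B ab have m: "magic_block (entry B a' b)" by (simp add: modular_magic_iff)
  have e: "entry B' a b i j = B (f (3 * a + i + 1), 3 * b + j + 1)" if "i < 3" "j < 3" for i j
    unfolding entry_def using ab that by (intro eq line_mem)
  from a'(2) show "magic_block (entry B' a b)"
  proof
    assume *: "\<forall>i<3. f (3 * a + i + 1) = 3 * a' + i + 1"
    show ?thesis
      by (rule magic_block_cong[OF m]) (use e * in \<open>simp only: entry_def\<close>)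
  next
    assume *: "\<forall>i<3. f (3 * a + i + 1) = 3 * a' + (2 - i) + 1"
    show ?thesis
      by (rule magic_block_cong[OF magic_block_flip[OF m]]) (use e * in \<open>simp only: entry_def\<close>)
  qed
qed (fact ext)

lemma transpose_Hmm: "transpose_cells \<in> Hmm"
  and act_transpose: "r \<in> {1..9} \<Longrightarrow> c \<in> {1..9} \<Longrightarrow> act transpose_cells B (r, c) = B (c, r)"
proof -
  show act: "act transpose_cells B (r, c) = B (c, r)" if "r \<in> {1..9}" "c \<in> {1..9}" for B r c
    using act_apply[OF transpose_cells_permutes, of B "(c, r)"] that
    by (simp add: transpose_cells_def cells_def)
  have "modular_magic (act transpose_cells B)" if "modular_magic B" for B
    by (rule modular_magic_transpose[OF that act_extensional[OF transpose_cells_permutes] act])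
      (use that in \<open>simp_all add: modular_magic_iff\<close>)
  then show "transpose_cells \<in> Hmm"
    by (simp add: Hmm_def H9_generator H9_generators_def)
qed

lemma entry_transpose:
  "a < 3 \<Longrightarrow> b < 3 \<Longrightarrow> i < 3 \<Longrightarrow> j < 3 \<Longrightarrow> entry (act transpose_cells B) a b i j = entry B b a j i"
  unfolding entry_def by (intro act_transpose line_mem)

lemma act_row_map:
  assumes "line_perm f" "r' \<in> {1..9}" "f r' = r" "c \<in> {1..9}"
  shows "act (row_map f) B (r, c) = B (r', c)"
  using act_apply[OF row_map_permutes[OF assms(1)], of B "(r', c)"] assms
  by (simp add: row_map_def cells_def)

text \<open>\<open>h\<close> inverts \<open>f\<close> on the lines; the condition on bands is placed
  on \<open>h\<close> because the new board is read through it.\<close>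

lemma row_map_Hmm:
  assumes f: "line_perm f" and H9: "row_map f \<in> H9"
    and h: "line_perm h" "\<And>r. r \<in> {1..9} \<Longrightarrow> f (h r) = r"
    and rev: "\<And>a. a < 3 \<Longrightarrow> \<exists>a'<3. (\<forall>i<3. h (3 * a + i + 1) = 3 * a' + i + 1) \<or>
                (\<forall>i<3. h (3 * a + i + 1) = 3 * a' + (2 - i) + 1)"
  shows "row_map f \<in> Hmm"
proof -
  have "modular_magic (act (row_map f) B)" if B: "modular_magic B" for B
  proof (rule modular_magic_rearrange_rows[OF B _ h(1) _ rev])
    show "act (row_map f) B \<in> extensional cells"
      using B by (intro act_extensional row_map_permutes f) (simp add: modular_magic_iff)
    show "act (row_map f) B (r, c) = B (h r, c)" if "r \<in> {1..9}" "c \<in> {1..9}" for r c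
      by (rule act_row_map) (use f h that line_perm_mem in simp_all)
  qed
  with H9 show ?thesis by (simp add: Hmm_def)
qed

definition flip_lines :: "nat set \<Rightarrow> nat \<Rightarrow> nat" where
  "flip_lines F r = (if (r - 1) div 3 \<in> F then 3 * ((r - 1) div 3) + (2 - (r - 1) mod 3) + 1 else r)"

lemma flip_lines_line:
  "i < 3 \<Longrightarrow> flip_lines F (3 * a + i + 1) = 3 * a + (if a \<in> F then 2 - i else i) + 1"
  by (simp add: flip_lines_def)

lemma line_perm_flip_lines: "line_perm (flip_lines F)"
  by (rule line_permI[where \<pi> = "\<lambda>a. a" and \<phi> = "\<lambda>a i. if a \<in> F then 2 - i else i"])
    (auto simp: flip_lines_line[simplified] inj_on_def)

lemma flip_lines_flip_lines:
  assumes "r \<in> {1..9}"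
  shows "flip_lines F (flip_lines F r) = r"
  using assms
proof (cases r rule: line_cases)
  case (1 a i)
  then show ?thesis using flip_lines_line[of i F a] flip_lines_line[of "2 - i" F a] by auto
qed

lemma row_map_comp: "line_perm g \<Longrightarrow> row_map (f \<circ> g) = row_map f \<circ> row_map g"
  using line_perm_mem[of g] by (auto simp: fun_eq_iff row_map_def cells_def)

lemma row_map_cong: "(\<And>r. r \<in> {1..9} \<Longrightarrow> f r = g r) \<Longrightarrow> row_map f = row_map g"
  by (auto simp: fun_eq_iff row_map_def cells_def)

lemma row_map_flip_lines_H9:
  assumes "F \<subseteq> {0..<3}"
  shows "row_map (flip_lines F) \<in> H9"
proof -
  have "finite F" using assms finite_subset by blast
  then show ?thesis using assms
  proof (induction F rule: finite_induct)
    case empty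
    have "row_map (flip_lines {}) = id" by (auto simp: row_map_def flip_lines_def fun_eq_iff)
    then show ?case using H9.H9_id by metis
  next
    case (insert a F)
    \<comment> \<open>Exchanging 0 and 2 reverses three positions, so one generator within a band
      reverses that band.\<close>
    define p where "p = Transposition.transpose (0::nat) 2"
    have p: "p permutes {0..<3}" unfolding p_def by (rule permutes_swap_id) simp_all
    have p_eq: "p i = 2 - i" if "i < 3" for i
      using that by (auto simp: p_def Transposition.transpose_def)
    have "row_map (flip_lines (insert a F)) = row_map (within_perm a p \<circ> flip_lines F)"
    proof (rule row_map_cong)
      fix r :: nat assume "r \<in> {1..9}"
      then show "flip_lines (insert a F) r = (within_perm a p \<circ> flip_lines F) r"
      proof (cases r rule: line_cases)
        case (1 b i)
        with insert.hyps show ?thesis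
          using flip_lines_line[of i F b] flip_lines_line[of i "insert a F" b] p_eq[of i]
            within_perm_line[of i a p b] within_perm_line[of "2 - i" a p b] by auto
      qed
    qed
    then have "row_map (flip_lines (insert a F)) = row_map (within_perm a p) \<circ> row_map (flip_lines F)"
      by (simp add: row_map_comp line_perm_flip_lines)
    moreover have "row_map (within_perm a p) \<in> H9"
      using insert.prems p by (intro H9_generator) (auto simp: H9_generators_def)
    moreover have "row_map (flip_lines F) \<in> H9" using insert by simp
    ultimately show ?case using H9_comp by presburger
  qed
qed

lemma flip_bands:
  assumes "F \<subseteq> {0..<3}"
  obtains g where "g \<in> Hmm"
    "\<And>B a b i j. a < 3 \<Longrightarrow> b < 3 \<Longrightarrow> i < 3 \<Longrightarrow> j < 3 \<Longrightarrow>
       entry (act g B) a b i j = entry B a b (if a \<in> F then 2 - i else i) j"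
proof
  show "row_map (flip_lines F) \<in> Hmm"
    using line_perm_flip_lines row_map_flip_lines_H9[OF assms] line_perm_flip_lines flip_lines_flip_lines
  proof (rule row_map_Hmm)
    fix a :: nat assume "a < 3"
    then show "\<exists>a'<3. (\<forall>i<3. flip_lines F (3 * a + i + 1) = 3 * a' + i + 1) \<or>
                (\<forall>i<3. flip_lines F (3 * a + i + 1) = 3 * a' + (2 - i) + 1)"
      by (intro exI[of _ a]) (simp add: flip_lines_line[simplified])
  qed
  show "entry (act (row_map (flip_lines F)) B) a b i j = entry B a b (if a \<in> F then 2 - i else i) j"
    if "a < 3" "b < 3" "i < 3" "j < 3" for B a b i j
    unfolding entry_def
  proof (rule act_row_map[OF line_perm_flip_lines])
    show "3 * a + (if a \<in> F then 2 - i else i) + 1 \<in> {1..9}" "3 * b + j + 1 \<in> {1..9}"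
      using that by auto
    show "flip_lines F (3 * a + (if a \<in> F then 2 - i else i) + 1) = 3 * a + i + 1"
      using that by (subst flip_lines_line) auto
  qed
qed

lemma permute_bands:
  assumes p: "p permutes {0..<3}"
  obtains g where "g \<in> Hmm"
    "\<And>B a b i j. a < 3 \<Longrightarrow> b < 3 \<Longrightarrow> i < 3 \<Longrightarrow> j < 3 \<Longrightarrow>
       entry (act g B) a b i j = entry B (p a) b i j"
proof
  \<comment> \<open>Entries are moved by the inverse, so that the new band \<open>a\<close> shows
    the old band \<open>p a\<close>.\<close>
  let ?q = "Hilbert_Choice.inv p"
  have q: "?q permutes {0..<3}" using p by (rule permutes_inv)
  have qp: "?q (p a) = a" for a using p by (simp add: permutes_inverses)
  show "row_map (band_perm ?q) \<in> Hmm"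
  proof (rule row_map_Hmm[where h = "band_perm p"])
    show "row_map (band_perm ?q) \<in> H9"
      using q by (intro H9_generator) (auto simp: H9_generators_def)
    show "band_perm ?q (band_perm p r) = r" if "r \<in> {1..9}" for r
      using that
    proof (cases r rule: line_cases)
      case (1 a i)
      then show ?thesis using qp by (simp add: band_perm_line[simplified])
    qed
    show "\<exists>a'<3. (\<forall>i<3. band_perm p (3 * a + i + 1) = 3 * a' + i + 1) \<or>
                (\<forall>i<3. band_perm p (3 * a + i + 1) = 3 * a' + (2 - i) + 1)" if "a < 3" for a
      using that p by (intro exI[of _ "p a"]) (simp add: band_perm_line[simplified] permutes_less_3)
  qed (use p q line_perm_band_perm in simp_all)
  show "entry (act (row_map (band_perm ?q)) B) a b i j = entry B (p a) b i j"
    if "a < 3" "b < 3" "i < 3" "j < 3" for B a b i j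
    unfolding entry_def
  proof (rule act_row_map[OF line_perm_band_perm[OF q]])
    show "3 * p a + i + 1 \<in> {1..9}" "3 * b + j + 1 \<in> {1..9}"
      using that permutes_less_3[OF p, of a] by auto
    show "band_perm ?q (3 * p a + i + 1) = 3 * a + i + 1"
      using that by (simp only: band_perm_line qp)
  qed
qed

text \<open>Conjugation by the transpose turns operations on bands into operations on
  pillars.\<close>

lemma transpose_conjugate:
  assumes g: "g \<in> Hmm"
  obtains h where "h \<in> Hmm" "\<And>B. act h B = act transpose_cells (act g (act transpose_cells B))"
proof
  show "transpose_cells \<circ> (g \<circ> transpose_cells) \<in> Hmm"
    by (intro Hmm_comp g transpose_Hmm)
  show "act (transpose_cells \<circ> (g \<circ> transpose_cells)) B = act transpose_cells (act g (act transpose_cells B))" for B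
    using Hmm_permutes[OF g] transpose_cells_permutes by (simp add: act_comp permutes_compose)
qed

lemma flip_pillars:
  assumes "F \<subseteq> {0..<3}"
  obtains g where "g \<in> Hmm"
    "\<And>B a b i j. a < 3 \<Longrightarrow> b < 3 \<Longrightarrow> i < 3 \<Longrightarrow> j < 3 \<Longrightarrow>
       entry (act g B) a b i j = entry B a b i (if b \<in> F then 2 - j else j)"
proof -
  obtain g where g: "g \<in> Hmm" "\<And>B a b i j. a < 3 \<Longrightarrow> b < 3 \<Longrightarrow> i < 3 \<Longrightarrow> j < 3 \<Longrightarrow>
       entry (act g B) a b i j = entry B a b (if a \<in> F then 2 - i else i) j"
    using flip_bands[OF assms] by metis
  obtain h where h: "h \<in> Hmm" "\<And>B. act h B = act transpose_cells (act g (act transpose_cells B))"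
    using transpose_conjugate[OF g(1)] by metis
  show ?thesis by (rule that[OF h(1)]) (auto simp: h(2) entry_transpose g(2))
qed

lemma permute_pillars:
  assumes p: "p permutes {0..<3}"
  obtains g where "g \<in> Hmm"
    "\<And>B a b i j. a < 3 \<Longrightarrow> b < 3 \<Longrightarrow> i < 3 \<Longrightarrow> j < 3 \<Longrightarrow>
       entry (act g B) a b i j = entry B a (p b) i j"
proof -
  obtain g where g: "g \<in> Hmm" "\<And>B a b i j. a < 3 \<Longrightarrow> b < 3 \<Longrightarrow> i < 3 \<Longrightarrow> j < 3 \<Longrightarrow>
       entry (act g B) a b i j = entry B (p a) b i j"
    using permute_bands[OF assms] by metis
  obtain h where h: "h \<in> Hmm" "\<And>B. act h B = act transpose_cells (act g (act transpose_cells B))"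
    using transpose_conjugate[OF g(1)] by metis
  show ?thesis by (rule that[OF h(1)]) (simp add: h(2) entry_transpose g(2) permutes_less_3[OF p])
qed

section \<open>Standard form of the diagonals and centres\<close>

lemma entry_block: "modular_magic B \<Longrightarrow> a < 3 \<Longrightarrow> b < 3 \<Longrightarrow> magic_block (entry B a b)"
  by (simp add: modular_magic_iff)

lemma entry_row_eq:
  assumes "modular_magic B" "entry B a b i j = entry B a b' i j'"
    "a < 3" "b < 3" "i < 3" "j < 3" "b' < 3" "j' < 3"
  shows "b = b' \<and> j = j'"
proof -
  have "inj_on (\<lambda>c. B (3 * a + i + 1, c)) {1..9}"
    using assms line_mem[of a i] by (auto simp: modular_magic_iff)
  then have "3 * b + j + 1 = 3 * b' + j' + 1"
    using assms(2) unfolding entry_def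
    by (rule inj_onD) (rule line_mem[OF assms(4,6)], rule line_mem[OF assms(7,8)])
  then have "(3 * b + j) div 3 = (3 * b' + j') div 3" "(3 * b + j) mod 3 = (3 * b' + j') mod 3"
    by simp_all
  with assms(6,8) show ?thesis by simp
qed

lemma entry_less_9:
  "modular_magic B \<Longrightarrow> a < 3 \<Longrightarrow> b < 3 \<Longrightarrow> i < 3 \<Longrightarrow> j < 3 \<Longrightarrow> entry B a b i j < 9"
  using entry_block[of B a b] unfolding magic_block_def by blast

definition upward :: "board \<Rightarrow> nat \<Rightarrow> nat \<Rightarrow> bool" where
  "upward B a b \<longleftrightarrow> (entry B a b 1 1 + 6) mod 9 \<in> {entry B a b 0 0, entry B a b 0 2}"

lemma upward_cases:
  assumes "modular_magic B" "a < 3" "b < 3"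
  shows "upward B a b \<and> (entry B a b 1 1 + 3) mod 9 \<in> {entry B a b 2 0, entry B a b 2 2} \<or>
    \<not> upward B a b \<and> (entry B a b 1 1 + 3) mod 9 \<in> {entry B a b 0 0, entry B a b 0 2} \<and>
      (entry B a b 1 1 + 6) mod 9 \<in> {entry B a b 2 0, entry B a b 2 2}"
proof -
  let ?e = "entry B a b 1 1"
  note shape = magic_block_shape[OF entry_block[OF assms]]
  have "3 dvd (?e + 6) mod 9" "(?e + 6) mod 9 \<noteq> (?e + 3) mod 9" using shape(1) by auto
  then show ?thesis using shape(6) unfolding upward_def insert_iff empty_iff by metis
qed

text \<open>
  Otherwise corner entries of the two blocks would collide in the first or the last row.
\<close>

lemma upward_band:
  assumes B: "modular_magic B" and ab: "a < 3" "b < 3" "b' < 3" and up: "upward B a b"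
  shows "upward B a b'"
proof (rule ccontr)
  assume not_up: "\<not> upward B a b'"
  then have "b \<noteq> b'" using up by blast
  note neq = this entry_row_eq[OF B, of a b _ _ b']
  have e: "entry B a b 1 1 \<in> {0, 3, 6}" "entry B a b' 1 1 \<in> {0, 3, 6}"
    using magic_block_shape(1) entry_block[OF B] ab by blast+
  have "(entry B a b 1 1 + 6) mod 9 \<in> {entry B a b 0 0, entry B a b 0 2}"
    "(entry B a b 1 1 + 3) mod 9 \<in> {entry B a b 2 0, entry B a b 2 2}"
    using upward_cases[OF B ab(1,2)] up by (auto simp: upward_def)
  moreover have "(entry B a b' 1 1 + 3) mod 9 \<in> {entry B a b' 0 0, entry B a b' 0 2}"
    "(entry B a b' 1 1 + 6) mod 9 \<in> {entry B a b' 2 0, entry B a b' 2 2}"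
    using upward_cases[OF B ab(1,3)] not_up by auto
  ultimately have "(entry B a b 1 1 + 6) mod 9 \<noteq> (entry B a b' 1 1 + 3) mod 9"
    "(entry B a b 1 1 + 3) mod 9 \<noteq> (entry B a b' 1 1 + 6) mod 9"
    using neq(1) neq(2)[of 0 0 0] neq(2)[of 0 0 2] neq(2)[of 0 2 0] neq(2)[of 0 2 2]
      neq(2)[of 2 0 0] neq(2)[of 2 0 2] neq(2)[of 2 2 0] neq(2)[of 2 2 2] ab by auto
  moreover have "entry B a b 1 1 \<noteq> entry B a b' 1 1"
    using neq ab by fastforce
  \<comment> \<open>Distinct centres among 0, 3, 6 differ by 3 or 6 modulo 9, and each case is
    excluded by one of the two preceding inequalities.\<close>
  ultimately show False using e by auto
qed

definition aligned :: "board \<Rightarrow> bool" where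
  "aligned B \<longleftrightarrow> (\<forall>a<3. \<forall>b<3. entry B a b 0 0 = (entry B a b 1 1 + 6) mod 9 \<and>
     entry B a b 2 2 = (entry B a b 1 1 + 3) mod 9)"

text \<open>The entry $e-3$ lies in the first row and, by the transposed condition, in the first
  column. If it were not the upper left entry, it would stand at both ends of the other
  diagonal.\<close>

lemma upward_imp_aligned:
  assumes "modular_magic B" "a < 3" "b < 3" "upward B a b" "upward (act transpose_cells B) b a"
  shows "entry B a b 0 0 = (entry B a b 1 1 + 6) mod 9 \<and>
     entry B a b 2 2 = (entry B a b 1 1 + 3) mod 9"
proof -
  let ?e = "entry B a b 1 1"
  note shape = magic_block_shape[OF entry_block[OF assms(1-3)]]
  have "(?e + 6) mod 9 = entry B a b 0 0 \<or> (?e + 6) mod 9 = entry B a b 0 2"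
    using assms(4) by (simp add: upward_def)
  moreover have "(?e + 6) mod 9 = entry B a b 0 0 \<or> (?e + 6) mod 9 = entry B a b 2 0"
    using assms(2,3,5) by (simp add: upward_def entry_transpose)
  moreover have "3 dvd (?e + 6) mod 9" "3 dvd (?e + 3) mod 9" "(?e + 6) mod 9 \<noteq> (?e + 3) mod 9"
    using shape(1) by auto
  ultimately show ?thesis using shape(6) by metis
qed

lemma Hmm_modular_magic: "g \<in> Hmm \<Longrightarrow> modular_magic B \<Longrightarrow> modular_magic (act g B)"
  by (simp add: Hmm_def)

lemma inv_transpose_cells: "Hilbert_Choice.inv transpose_cells = transpose_cells"
  by (rule inv_equality) (auto simp: transpose_cells_def cells_def split: if_splits)

lemma transpose_transpose: "act transpose_cells (act transpose_cells B) = B"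
  unfolding act_def inv_transpose_cells by (auto simp: transpose_cells_def cells_def fun_eq_iff)

text \<open>Reversing the bands that are not upward only permutes the first column of each block.
  Hence the horizontal sense is kept, and \<open>exists_aligned\<close> can repeat the step on the
  transposed board without undoing the first one.\<close>

lemma exists_upward:
  assumes B: "modular_magic B"
  obtains g where "g \<in> Hmm" "\<And>a b. a < 3 \<Longrightarrow> b < 3 \<Longrightarrow> upward (act g B) a b"
    "\<And>a b. a < 3 \<Longrightarrow> b < 3 \<Longrightarrow> upward (act transpose_cells (act g B)) a b \<longleftrightarrow>
       upward (act transpose_cells B) a b"
proof -
  define F where "F = {a \<in> {0..<3}. \<not> upward B a 0}"
  have "F \<subseteq> {0..<3}" by (auto simp: F_def)
  then obtain g where g: "g \<in> Hmm"
    and ent: "\<And>B a b i j. a < 3 \<Longrightarrow> b < 3 \<Longrightarrow> i < 3 \<Longrightarrow> j < 3 \<Longrightarrow>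
       entry (act g B) a b i j = entry B a b (if a \<in> F then 2 - i else i) j"
    by (rule flip_bands) blast
  show ?thesis
  proof
    show "upward (act g B) a b" if ab: "a < 3" "b < 3" for a b
    proof (cases "a \<in> F")
      case True
      then have "\<not> upward B a b" using upward_band[OF B ab(1) ab(2), of 0] by (auto simp: F_def)
      then show ?thesis
        using upward_cases[OF B ab] True ab by (auto simp: upward_def ent)
    next
      case False
      then have "upward B a b" using upward_band[OF B ab(1) _ ab(2), of 0] ab by (auto simp: F_def)
      then show ?thesis using False ab by (simp add: upward_def ent)
    qed
    show "upward (act transpose_cells (act g B)) a b \<longleftrightarrow> upward (act transpose_cells B) a b"
      if "a < 3" "b < 3" for a b
      using that by (auto simp: upward_def ent entry_transpose)
  qed (fact g)
qed

lemma exists_aligned: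
  assumes B: "modular_magic B"
  obtains g where "g \<in> Hmm" "aligned (act g B)"
proof -
  let ?T = "act transpose_cells"
  obtain g where g: "g \<in> Hmm" "\<And>a b. a < 3 \<Longrightarrow> b < 3 \<Longrightarrow> upward (act g B) a b"
    using exists_upward[OF B] by metis
  define C where "C = ?T (act g B)"
  have C: "modular_magic C" using B g transpose_Hmm by (simp add: C_def Hmm_modular_magic)
  have TC: "?T C = act g B"
    by (simp only: C_def transpose_transpose)
  obtain h where h: "h \<in> Hmm" "\<And>a b. a < 3 \<Longrightarrow> b < 3 \<Longrightarrow> upward (act h C) a b"
    "\<And>a b. a < 3 \<Longrightarrow> b < 3 \<Longrightarrow> upward (?T (act h C)) a b \<longleftrightarrow> upward (?T C) a b"
    using exists_upward[OF C] by metis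
  have D: "modular_magic (act h C)" using C h by (simp add: Hmm_modular_magic)
  have "aligned (act h C)"
    unfolding aligned_def using upward_imp_aligned[OF D] h g(2) TC by auto
  moreover have "act h C = act (h \<circ> (transpose_cells \<circ> g)) B"
    using g(1) h(1) Hmm_permutes transpose_cells_permutes
    by (simp only: act_comp permutes_compose C_def)
  moreover have "h \<circ> (transpose_cells \<circ> g) \<in> Hmm"
    by (intro Hmm_comp g h transpose_Hmm)
  ultimately show ?thesis using that by metis
qed

section \<open>The Latin square of centres\<close>

lemma triple_permutation:
  assumes f: "inj_on f {0..<3}" "f ` {0..<3} \<subseteq> {0, 3, 6::nat}"
  obtains p where "p permutes {0..<3::nat}" "\<And>b. b < 3 \<Longrightarrow> f (p b) = 3 * ((b + 1) mod 3)"
proof -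
  have f_bij: "bij_betw f {0..<3} {0, 3, 6}"
    using f by (subst bij_betw_iff_inj_on_card) auto
  have "{0..<3::nat} = {0, 1, 2}" by auto
  then have h: "bij_betw (\<lambda>b. 3 * ((b + 1) mod 3)) {0..<3::nat} {0, 3, 6::nat}"
    by (auto simp: bij_betw_def)
  let ?p = "\<lambda>b. if b \<in> {0..<3} then inv_into {0..<3} f (3 * ((b + 1) mod 3)) else b"
  have "bij_betw (inv_into {0..<3} f \<circ> (\<lambda>b. 3 * ((b + 1) mod 3))) {0..<3} {0..<3}"
    using h bij_betw_inv_into[OF f_bij] by (rule bij_betw_trans)
  then have "bij_betw ?p {0..<3} {0..<3}"
    by (rule bij_betw_cong[THEN iffD1, rotated]) simp
  then have "?p permutes {0..<3}" by (rule bij_imp_permutes) simp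
  moreover have "f (?p b) = 3 * ((b + 1) mod 3)" if "b < 3" for b
    using that bij_betw_inv_into_right[OF f_bij] bij_betwE[OF h] by simp
  ultimately show ?thesis by (rule that)
qed

text \<open>The prescribed values depend on band and pillar only through \<open>a + b\<close>, which
  makes them invariant under the transpose and under opposite shifts of bands and pillars.\<close>

definition base :: "board \<Rightarrow> bool" where
  "base B \<longleftrightarrow> (\<forall>a<3. \<forall>b<3. \<forall>i<3. entry B a b i i = 3 * ((a + b + i) mod 3))"

lemma canonical_iff_base:
  "canonical B \<longleftrightarrow> base B \<and> B (1, 3) < B (3, 1) \<and> B (4, 9) = B (7, 6)"
  unfolding canonical_def base_def All_less_3 entry_def
  by (simp del: One_nat_def) blast

text \<open>The centres form a Latin square on 0, 3, 6, which its first row and column determine;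
  alignment then gives the other diagonal entries.\<close>

lemma base_aligned:
  assumes B: "modular_magic B" and al: "aligned B"
    and row: "\<And>b. b < 3 \<Longrightarrow> entry B 0 b 1 1 = 3 * ((b + 1) mod 3)"
    and col: "\<And>a. a < 3 \<Longrightarrow> entry B a 0 1 1 = 3 * ((a + 1) mod 3)"
  shows "base B"
proof -
  let ?e = "\<lambda>a b. entry B a b 1 1"
  have e: "?e a b \<in> {0, 3, 6}" if "a < 3" "b < 3" for a b
    using magic_block_shape(1) entry_block[OF B] that by blast
  have rowneq: "?e a b \<noteq> ?e a b'" if "a < 3" "b < 3" "b' < 3" "b \<noteq> b'" for a b b'
    using entry_row_eq[OF B, of a b 1 1 b' 1] that by auto
  have colneq: "?e a b \<noteq> ?e a' b" if "a < 3" "a' < 3" "b < 3" "a \<noteq> a'" for a a' b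
    using entry_row_eq[OF Hmm_modular_magic[OF transpose_Hmm B], of b a 1 1 a' 1] that
    by (auto simp: entry_transpose)
  have known: "?e 0 0 = 3" "?e 0 1 = 6" "?e 0 2 = 0" "?e 1 0 = 6" "?e 2 0 = 0"
    using row[of 0] row[of 1] row[of 2] col[of 1] col[of 2] by simp_all
  have "?e 1 2 = 3"
    using e[of 1 2] rowneq[of 1 0 2] colneq[of 0 1 2] known by auto
  moreover from this have "?e 1 1 = 0"
    using e[of 1 1] rowneq[of 1 0 1] rowneq[of 1 1 2] known by auto
  moreover from this have "?e 2 1 = 3"
    using e[of 2 1] colneq[of 0 2 1] colneq[of 1 2 1] known by auto
  moreover from this have "?e 2 2 = 6"
    using e[of 2 2] rowneq[of 2 0 2] rowneq[of 2 1 2] known by auto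
  ultimately show ?thesis
    using al known unfolding base_def aligned_def All_less_3 by simp
qed

lemma exists_base:
  assumes B: "modular_magic B"
  obtains g where "g \<in> Hmm" "base (act g B)"
proof -
  obtain f where f: "f \<in> Hmm" "aligned (act f B)" by (rule exists_aligned[OF B])
  define C where "C = act f B"
  have C: "modular_magic C" "aligned C"
    using B f by (simp_all add: C_def Hmm_modular_magic)
  have e: "entry C a b 1 1 \<in> {0, 3, 6}" if "a < 3" "b < 3" for a b
    using magic_block_shape(1) entry_block[OF C(1)] that by blast
  have "inj_on (\<lambda>b. entry C 0 b 1 1) {0..<3}"
    using entry_row_eq[OF C(1), of 0 _ 1 1 _ 1] by (auto intro!: inj_onI)
  moreover have "(\<lambda>b. entry C 0 b 1 1) ` {0..<3} \<subseteq> {0, 3, 6}"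
    by (intro image_subsetI e) simp_all
  ultimately obtain q where q: "q permutes {0..<3}"
    "\<And>b. b < 3 \<Longrightarrow> entry C 0 (q b) 1 1 = 3 * ((b + 1) mod 3)"
    by (rule triple_permutation) blast
  obtain g where g: "g \<in> Hmm"
    "\<And>B a b i j. a < 3 \<Longrightarrow> b < 3 \<Longrightarrow> i < 3 \<Longrightarrow> j < 3 \<Longrightarrow>
       entry (act g B) a b i j = entry B a (q b) i j"
    using permute_pillars[OF q(1)] by metis
  define D where "D = act g C"
  have D: "modular_magic D" "aligned D"
    using C g permutes_less_3[OF q(1)] by (simp_all add: D_def Hmm_modular_magic aligned_def)
  have D_row: "entry D 0 b 1 1 = 3 * ((b + 1) mod 3)" if "b < 3" for b
    using that g(2) q(2) by (simp add: D_def)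
  have DT: "modular_magic (act transpose_cells D)"
    using D transpose_Hmm by (simp add: Hmm_modular_magic)
  have D_inj: "inj_on (\<lambda>a. entry D a 0 1 1) {0..<3}"
    using entry_row_eq[OF DT, of 0 _ 1 1 _ 1] by (auto intro!: inj_onI simp: entry_transpose)
  moreover have "(\<lambda>a. entry D a 0 1 1) ` {0..<3} \<subseteq> {0, 3, 6}"
    by (intro image_subsetI magic_block_shape(1) entry_block[OF D(1)]) simp_all
  ultimately obtain p where p: "p permutes {0..<3}"
    "\<And>a. a < 3 \<Longrightarrow> entry D (p a) 0 1 1 = 3 * ((a + 1) mod 3)"
    by (rule triple_permutation) blast
  \<comment> \<open>The pillars are already in order. The centre of block (0,0) has its required
    value 3, so sorting the bands leaves band 0 in place and does not disturb the first row of
    centres.\<close>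
  have "p 0 = 0"
    using inj_onD[OF D_inj, of "p 0" 0] p(2)[of 0] D_row[of 0] permutes_less_3[OF p(1), of 0] by simp
  obtain h where h: "h \<in> Hmm"
    "\<And>B a b i j. a < 3 \<Longrightarrow> b < 3 \<Longrightarrow> i < 3 \<Longrightarrow> j < 3 \<Longrightarrow>
       entry (act h B) a b i j = entry B (p a) b i j"
    using permute_bands[OF p(1)] by metis
  have "base (act h D)"
  proof (rule base_aligned)
    show "modular_magic (act h D)" "aligned (act h D)"
      using D h permutes_less_3[OF p(1)] by (simp_all add: Hmm_modular_magic aligned_def)
    show "entry (act h D) 0 b 1 1 = 3 * ((b + 1) mod 3)" if "b < 3" for b
      using that h(2) D_row \<open>p 0 = 0\<close> by simp
    show "entry (act h D) a 0 1 1 = 3 * ((a + 1) mod 3)" if "a < 3" for a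
      using that h(2) p(2) by simp
  qed
  moreover have "act h D = act (h \<circ> (g \<circ> f)) B"
    using f(1) g(1) h(1) Hmm_permutes by (simp only: act_comp permutes_compose C_def D_def)
  moreover have "h \<circ> (g \<circ> f) \<in> Hmm"
    by (intro Hmm_comp f g h)
  ultimately show ?thesis using that by metis
qed

section \<open>The remaining parameter of a block\<close>

text \<open>
  In a board of standard form with corner $d$, the other two entries $x$ and $-d-x$ of the first row of a
  block are symmetric about $-d/2 = -5d$ modulo 9, so $(x+5d)^2$ encodes the unordered pair.
\<close>

definition twist :: "board \<Rightarrow> nat \<Rightarrow> nat \<Rightarrow> nat" where
  "twist B a b = (entry B a b 0 2 + 5 * entry B a b 0 0) mod 9"

lemma base_corner:
  assumes "base B" "a < 3" "b < 3"
  shows "entry B a b 0 0 = 0 \<and> entry B a b 1 1 = 3 \<or> entry B a b 0 0 = 3 \<and> entry B a b 1 1 = 6 \<or>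
    entry B a b 0 0 = 6 \<and> entry B a b 1 1 = 0"
proof -
  have "entry B a b 0 0 = 3 * ((a + b + 0) mod 3)" "entry B a b 1 1 = 3 * ((a + b + 1) mod 3)"
    using assms unfolding base_def by fastforce+
  then show ?thesis by (simp add: mod_Suc) linarith
qed

lemma base_not_dvd:
  assumes "modular_magic B" "base B" "a < 3" "b < 3"
  shows "\<not> 3 dvd entry B a b 0 2"
proof -
  have "entry B a b 0 0 = 3 * ((a + b) mod 3)" using assms(2-4) unfolding base_def by auto
  then have "3 dvd entry B a b 0 0" by simp
  with magic_block_shape(6)[OF entry_block[OF assms(1,3,4)]] show ?thesis by blast
qed

lemma base_transpose: "base B \<Longrightarrow> base (act transpose_cells B)"
  unfolding base_def by (metis add.commute entry_transpose)


text \<open>For $d$ in 0, 3, 6 we have $4d = d$ modulo 9, so with twist $t$ the two entries beside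
  the corner are $d+t$ and $d-t$. Choose signs so that $t$ and $t'$ are 1 modulo 3. Distinctness
  then excludes both nonzero multiples of 3 as values of $t-t'$, hence $t' = t$ up to sign.\<close>

lemma twist_row_table:
  "list_all (\<lambda>d. list_all (\<lambda>d'. list_all (\<lambda>x. list_all (\<lambda>x'.
      d \<noteq> d' \<and> \<not> 3 dvd x \<and> \<not> 3 dvd x' \<and>
      distinct [x, (18 - d - x) mod 9, x', (18 - d' - x') mod 9] \<longrightarrow>
      ((x + 5 * d) mod 9)^2 mod 9 = ((x' + 5 * d') mod 9)^2 mod 9)
     [0..<9]) [0..<9]) [0, 3, 6]) [0::nat, 3, 6]"
  by code_simp

lemma twist_band:
  assumes B: "modular_magic B" "base B" and ab: "a < 3" "b < 3" "b' < 3"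
  shows "(twist B a b)^2 mod 9 = (twist B a b')^2 mod 9"
proof (cases "b = b'")
  case False
  let ?d = "\<lambda>b. entry B a b 0 0" and ?x = "\<lambda>b. entry B a b 0 2"
  have mid: "entry B a b 0 1 = (18 - ?d b - ?x b) mod 9" if "b < 3" for b
    by (rule magic_block_entries) (rule entry_block[OF B(1) ab(1) that])
  have mem: "?d b \<in> set [0, 3, 6]" "?x b \<in> set [0..<9]" if "b < 3" for b
    using base_corner[OF B(2) ab(1) that] entry_less_9[OF B(1) ab(1) that] by auto
  have neq: "entry B a b 0 j \<noteq> entry B a b' 0 j'" if "j < 3" "j' < 3" for j j'
    using entry_row_eq[OF B(1), of a b 0 j b' j'] ab False that by auto
  have "?x b \<noteq> entry B a b 0 1" if "b < 3" for b
    using entry_row_eq[OF B(1), of a b 0 2 b 1] ab that by auto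
  then have "distinct [?x b, entry B a b 0 1, ?x b', entry B a b' 0 1]"
    using neq ab by simp
  then have "?d b \<noteq> ?d b' \<and> \<not> 3 dvd ?x b \<and> \<not> 3 dvd ?x b' \<and>
      distinct [?x b, (18 - ?d b - ?x b) mod 9, ?x b', (18 - ?d b' - ?x b') mod 9]"
    using neq[of 0 0] ab base_not_dvd[OF B ab(1)] mid by simp
  with bspec[OF bspec[OF bspec[OF bspec[OF twist_row_table[unfolded list_all_iff] mem(1)[OF ab(2)]]
      mem(1)[OF ab(3)]] mem(2)[OF ab(2)]] mem(2)[OF ab(3)]]
  show ?thesis unfolding twist_def by blast
qed simp

lemma twist_cases:
  assumes "modular_magic B" "base B" "a < 3" "b < 3"
  shows "twist B a b \<in> {1, 2, 4, 5, 7, 8}"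
proof -
  have "\<not> 3 dvd entry B a b 0 2" by (rule base_not_dvd[OF assms])
  moreover have "3 dvd entry B a b 0 0" using base_corner[OF assms(2-4)] by auto
  ultimately have "\<not> 3 dvd entry B a b 0 2 + 5 * entry B a b 0 0"
    by (simp add: dvd_add_left_iff)
  then have "\<not> 3 dvd twist B a b" by (simp add: twist_def dvd_mod_iff)
  moreover have "twist B a b < 9" by (simp add: twist_def)
  ultimately show ?thesis by simp presburger
qed

text \<open>The transposed block has upper right entry $-e-x$ with $e = d+3$, so its twist is $-3-t$
  modulo 9. The constant 15 represents $-3$ and lies above every $t$. The square of the new twist is
  $(t+3)^2$.\<close>

lemma twist_transpose:
  assumes "modular_magic B" "base B" "a < 3" "b < 3"
  shows "twist (act transpose_cells B) b a = (15 - twist B a b) mod 9"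
proof -
  let ?d = "entry B a b 0 0" and ?x = "entry B a b 0 2"
  have "entry B a b 2 0 = (18 - entry B a b 1 1 - ?x) mod 9"
    by (rule magic_block_entries) (rule entry_block[OF assms(1,3,4)])
  moreover have "?x \<in> set [0..<9]"
    using entry_less_9[OF assms(1,3,4)] by simp
  ultimately show ?thesis
    using base_corner[OF assms(2-4)] assms(3,4)
    unfolding twist_def by (auto simp: entry_transpose upt_rec)
qed

lemma twist_determines:
  assumes B: "modular_magic B" "base B" and C: "modular_magic C" "base C"
    and eq: "\<And>a b. a < 3 \<Longrightarrow> b < 3 \<Longrightarrow> twist B a b = twist C a b"
  shows "B = C"
proof -
  have ent: "\<forall>i<3. \<forall>j<3. entry B a b i j = entry C a b i j" if ab: "a < 3" "b < 3" for a b
  proof -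
    have "entry B a b i i = entry C a b i i" if "i < 3" for i
      using B C ab that by (simp add: base_def)
    then have d: "entry B a b 0 0 = entry C a b 0 0" "entry B a b 1 1 = entry C a b 1 1"
      "entry B a b 2 2 = entry C a b 2 2" by simp_all
    \<comment> \<open>As $4d = -5d$ modulo 9, twist and corner give back the upper right
      entry.\<close>
    have x: "entry X a b 0 2 = (twist X a b + 4 * entry X a b 0 0) mod 9" if "modular_magic X" for X
    proof -
      have "entry X a b 0 2 < 9"
        using entry_less_9[OF that ab] by simp
      then show ?thesis by (simp add: twist_def mod_simps)
    qed
    have "entry B a b 0 2 = entry C a b 0 2"
      using x[OF B(1)] x[OF C(1)] eq[OF ab] d by simp
    then show ?thesis
      unfolding All_less_3 by (simp only: magic_block_entries[OF entry_block[OF B(1) ab]]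
          magic_block_entries[OF entry_block[OF C(1) ab]] d simp_thms)
  qed
  show ?thesis
  proof (rule extensionalityI)
    show "B \<in> extensional cells" "C \<in> extensional cells"
      using B C by (simp_all add: modular_magic_iff)
    fix x assume "x \<in> cells"
    then obtain r c where x: "x = (r, c)" "r \<in> {1..9}" "c \<in> {1..9}" by (auto simp: cells_def)
    from x(2) obtain a i where "a < 3" "i < 3" "r = 3 * a + i + 1" by (rule line_cases)
    moreover from x(3) obtain b j where "b < 3" "j < 3" "c = 3 * b + j + 1" by (rule line_cases)
    ultimately show "B x = C x" using ent x(1) by (simp add: entry_def)
  qed
qed

text \<open>Units modulo 9 with equal squares agree up to sign. If $t' = -t$, then $(t+3)^2 =
  (3-t)^2$ would make $12t$ vanish modulo 9.\<close>

lemma twist_inject: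
  assumes "x \<in> {1, 2, 4, 5, 7, 8::nat}" "y \<in> {1, 2, 4, 5, 7, 8}"
    "x^2 mod 9 = y^2 mod 9" "((15 - x) mod 9)^2 mod 9 = ((15 - y) mod 9)^2 mod 9"
  shows "x = y"
  using assms by auto

text \<open>The squares of units modulo 9 are 1, 4, 7, and $(t+3)^2 - t^2 = 6t$ modulo 9 is nonzero
  for a unit $t$.\<close>

lemma twist_classes:
  assumes "x \<in> {1, 2, 4, 5, 7, 8::nat}"
  shows "x^2 mod 9 \<in> {1, 4, 7}" "((15 - x) mod 9)^2 mod 9 \<in> {1, 4, 7}"
    "((15 - x) mod 9)^2 mod 9 \<noteq> x^2 mod 9"
  using assms by auto

text \<open>The values of \<open>R\<close> and those of \<open>C\<close> are disjoint subsets of a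
  set of three, so one of the functions is constant and the other takes at most two values. The
  disjuncts pair the indices as coordinates of the blocks (0,0), (1,2), (2,1).\<close>

lemma disjoint_classes_equal_pair:
  fixes R C :: "nat \<Rightarrow> nat"
  assumes R: "\<And>a. a < 3 \<Longrightarrow> R a \<in> {1, 4, 7}" and C: "\<And>b. b < 3 \<Longrightarrow> C b \<in> {1, 4, 7}"
    and neq: "\<And>a b. a < 3 \<Longrightarrow> b < 3 \<Longrightarrow> C b \<noteq> R a"
  shows "R 0 = R 1 \<and> C 0 = C 2 \<or> R 1 = R 2 \<and> C 2 = C 1 \<or> R 0 = R 2 \<and> C 0 = C 1"
proof -
  have third: "x = y" if "x \<in> {1, 4, 7}" "y \<in> {1, 4, 7}" "p \<in> {1, 4, 7}" "q \<in> {1, 4, 7}"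
    "p \<noteq> q" "p \<noteq> x" "p \<noteq> y" "q \<noteq> x" "q \<noteq> y" for x y p q :: nat
    using that by (elim insertE emptyE) simp_all
  have lt: "0 < (3::nat)" "1 < (3::nat)" "2 < (3::nat)" by simp_all
  show ?thesis
  proof (cases "R 0 = R 1 \<and> R 1 = R 2")
    case True
    moreover have "C 0 = C 2 \<or> C 2 = C 1 \<or> C 0 = C 1"
      using third[OF C[OF lt(3)] R[OF lt(1)] C[OF lt(1)] C[OF lt(2)]] neq lt by metis
    ultimately show ?thesis by metis
  next
    case False
    then obtain a a' where a: "a < 3" "a' < 3" "R a \<noteq> R a'" using lt by metis
    have C_eq: "C b = C 0" if "b < 3" for b
      by (rule third[OF C[OF that] C[OF lt(1)] R[OF a(1)] R[OF a(2)]])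
        (use a neq[OF _ that] neq[OF _ lt(1)] in metis)+
    have "R 0 = R 1 \<or> R 1 = R 2 \<or> R 0 = R 2"
      using third[OF R[OF lt(3)] C[OF lt(1)] R[OF lt(1)] R[OF lt(2)]] neq lt by metis
    with C_eq lt show ?thesis by metis
  qed
qed

lemma entry_base: "base B \<Longrightarrow> a < 3 \<Longrightarrow> b < 3 \<Longrightarrow> i < 3 \<Longrightarrow> entry B a b i i = 3 * ((a + b + i) mod 3)"
  by (simp add: base_def)

text \<open>\<open>R\<close> is the square $t^2$ attached to a band, \<open>C\<close> the square
  $(t+3)^2$ attached to a pillar. Two of the three blocks with corner 0 agree in both squares, and
  these determine the twist.\<close>

lemma exists_equal_twists:
  assumes B: "modular_magic B" "base B"
  shows "twist B 0 0 = twist B 1 2 \<or> twist B 1 2 = twist B 2 1 \<or> twist B 0 0 = twist B 2 1"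
proof -
  define R where "R a = (twist B a 0)^2 mod 9" for a
  define C where "C b = ((15 - twist B 0 b) mod 9)^2 mod 9" for b
  note T = Hmm_modular_magic[OF transpose_Hmm B(1)] base_transpose[OF B(2)]
  have R: "(twist B a b)^2 mod 9 = R a" if "a < 3" "b < 3" for a b
    unfolding R_def using that by (intro twist_band B) simp_all
  have C: "((15 - twist B a b) mod 9)^2 mod 9 = C b" if "a < 3" "b < 3" for a b
    unfolding C_def using twist_band[OF T, of b a 0] that by (simp only: twist_transpose B)
  have "R 0 = R 1 \<and> C 0 = C 2 \<or> R 1 = R 2 \<and> C 2 = C 1 \<or> R 0 = R 2 \<and> C 0 = C 1"
  proof (rule disjoint_classes_equal_pair)
    fix a b :: nat assume ab: "a < 3" "b < 3"
    from twist_classes[OF twist_cases[OF B ab]] show "C b \<noteq> R a"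
      unfolding R[OF ab] C[OF ab] by blast
  next
    fix a :: nat assume a: "a < 3"
    show "R a \<in> {1, 4, 7}"
      using twist_classes(1)[OF twist_cases[OF B a, of 0]] R[OF a, of 0] by simp
    show "C a \<in> {1, 4, 7}"
      using twist_classes(2)[OF twist_cases[OF B _ a, of 0]] C[OF _ a, of 0] by simp
  qed
  moreover have "twist B a b = twist B a' b'"
    if "R a = R a'" "C b = C b'" "a < 3" "b < 3" "a' < 3" "b' < 3" for a b a' b'
    by (rule twist_inject[OF twist_cases[OF B that(3,4)] twist_cases[OF B that(5,6)]])
      (simp_all only: R C that)
  note this[of 0 1 0 2] this[of 1 2 2 1] this[of 0 2 0 1]
  ultimately show ?thesis by simp argo
qed

section \<open>Opposite shifts of bands and pillars\<close>

lemma shift_permutes: "(\<lambda>a. if a < 3 then (a + k) mod 3 else a) permutes {0..<3::nat}"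
proof (rule bij_imp_permutes)
  have "inj_on (\<lambda>a. if a < 3 then (a + k) mod 3 else a) {0..<3::nat}"
  proof (rule inj_onI)
    fix a b :: nat
    assume "a \<in> {0..<3}" "b \<in> {0..<3}"
      "(if a < 3 then (a + k) mod 3 else a) = (if b < 3 then (b + k) mod 3 else b)"
    then have ab: "a < 3" "b < 3" "(a + k) mod 3 = (b + k) mod 3" by simp_all
    from ab(3) have "a mod 3 = b mod 3" by (rule mod_add_cancel)
    with ab(1,2) show "a = b" by simp
  qed
  then show "bij_betw (\<lambda>a. if a < 3 then (a + k) mod 3 else a) {0..<3::nat} {0..<3}"
    by (subst bij_betw_iff_inj_on_card) auto
qed auto

text \<open>\<open>2 * k\<close> stands for $-k$ modulo 3, so the sum of band and pillar index is
  unchanged modulo 3.\<close>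

lemma shift_base:
  assumes B: "base B"
  obtains g where "g \<in> Hmm" "base (act g B)"
    "\<And>a b. a < 3 \<Longrightarrow> b < 3 \<Longrightarrow> twist (act g B) a b = twist B ((a + k) mod 3) ((b + 2 * k) mod 3)"
proof -
  obtain g where g: "g \<in> Hmm"
    "\<And>B a b i j. a < 3 \<Longrightarrow> b < 3 \<Longrightarrow> i < 3 \<Longrightarrow> j < 3 \<Longrightarrow>
       entry (act g B) a b i j = entry B (if a < 3 then (a + k) mod 3 else a) b i j"
    using permute_bands[OF shift_permutes[of k]] by blast
  obtain h where h: "h \<in> Hmm"
    "\<And>B a b i j. a < 3 \<Longrightarrow> b < 3 \<Longrightarrow> i < 3 \<Longrightarrow> j < 3 \<Longrightarrow>
       entry (act h B) a b i j = entry B a (if b < 3 then (b + 2 * k) mod 3 else b) i j"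
    using permute_pillars[OF shift_permutes[of "2 * k"]] by blast
  have ent: "entry (act (h \<circ> g) B) a b i j = entry B ((a + k) mod 3) ((b + 2 * k) mod 3) i j"
    if "a < 3" "b < 3" "i < 3" "j < 3" for a b i j
    unfolding act_comp[OF Hmm_permutes[OF h(1)] Hmm_permutes[OF g(1)]]
    using that g(2) h(2) by simp
  show ?thesis
  proof
    show "h \<circ> g \<in> Hmm" by (intro Hmm_comp g h)
    have "((a + k) mod 3 + (b + 2 * k) mod 3 + i) mod 3 = (a + b + i) mod 3" for a b i
    proof -
      have "((a + k) mod 3 + (b + 2 * k) mod 3 + i) mod 3 = ((a + k) + (b + 2 * k) + i) mod 3"
        by (metis mod_add_eq mod_add_left_eq)
      also have "(a + k) + (b + 2 * k) + i = (a + b + i) + 3 * k" by simp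
      finally show ?thesis by (simp only: mod_mult_self2)
    qed
    then show "base (act (h \<circ> g) B)"
      using B unfolding base_def by (simp add: ent)
    show "twist (act (h \<circ> g) B) a b = twist B ((a + k) mod 3) ((b + 2 * k) mod 3)"
      if "a < 3" "b < 3" for a b
      using that by (simp only: twist_def ent zero_less_numeral numeral_less_iff semiring_norm)
  qed
qed

text \<open>Both blocks have corner 0, so their twists are their upper right entries, in the cells
  (4,9) and (7,6).\<close>

lemma base_equal_twists_iff:
  assumes "modular_magic B" "base B"
  shows "twist B 1 2 = twist B 2 1 \<longleftrightarrow> B (4, 9) = B (7, 6)"
proof -
  have "entry B 1 2 0 2 < 9" "entry B 2 1 0 2 < 9"
    using entry_less_9[OF assms(1)] by simp_all
  moreover have "entry B 1 2 0 0 = 0" "entry B 2 1 0 0 = 0"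
    using entry_base[OF assms(2), of 1 2 0] entry_base[OF assms(2), of 2 1 0] by simp_all
  ultimately have "twist B 1 2 = entry B 1 2 0 2" "twist B 2 1 = entry B 2 1 0 2"
    by (simp_all add: twist_def)
  then show ?thesis by (simp add: entry_def)
qed

lemma exists_canonical:
  assumes B0: "modular_magic B0"
  obtains g where "g \<in> Hmm" "canonical (act g B0)"
proof -
  obtain f where f: "f \<in> Hmm" "base (act f B0)" by (rule exists_base[OF B0])
  define B where "B = act f B0"
  have B: "modular_magic B" "base B" using f B0 by (simp_all add: B_def Hmm_modular_magic)
  \<comment> \<open>Shifts permute the blocks (0,0), (1,2), (2,1) cyclically; \<open>k\<close>
    brings the pair with equal twists to (1,2) and (2,1).\<close>
  obtain k where k: "twist B ((1 + k) mod 3) ((2 + 2 * k) mod 3) = twist B ((2 + k) mod 3) ((1 + 2 * k) mod 3)"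
    using exists_equal_twists[OF B]
  proof (elim disjE)
    assume "twist B 0 0 = twist B 1 2"
    then show thesis by (intro that[of 2]) simp
  next
    assume "twist B 1 2 = twist B 2 1"
    then show thesis by (intro that[of 0]) simp
  next
    assume "twist B 0 0 = twist B 2 1"
    then show thesis by (intro that[of 1]) (simp add: numeral_2_eq_2)
  qed
  obtain g where g: "g \<in> Hmm" "base (act g B)"
    "\<And>a b. a < 3 \<Longrightarrow> b < 3 \<Longrightarrow> twist (act g B) a b = twist B ((a + k) mod 3) ((b + 2 * k) mod 3)"
    by (rule shift_base[OF B(2), of k]) blast
  define C where "C = act g B"
  have C: "modular_magic C" "base C" "twist C 1 2 = twist C 2 1"
    using g B k by (simp_all add: C_def Hmm_modular_magic)
  have CT: "modular_magic (act transpose_cells C)" "base (act transpose_cells C)"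
    using Hmm_modular_magic[OF transpose_Hmm C(1)] base_transpose[OF C(2)] .
  \<comment> \<open>The transpose exchanges the two blocks and changes both twists by the same
    map.\<close>
  have CT_twist: "twist (act transpose_cells C) 1 2 = twist (act transpose_cells C) 2 1"
    using C by (simp add: twist_transpose)
  have gf: "C = act (g \<circ> f) B0" "g \<circ> f \<in> Hmm"
    unfolding C_def B_def using f g Hmm_permutes by (simp_all only: act_comp Hmm_comp)
  \<comment> \<open>Both cells lie in one block, so the entries differ, and transposing reverses
    their order.\<close>
  have "entry C 0 0 0 2 \<noteq> entry C 0 0 2 0"
    using entry_block[OF C(1), of 0 0] unfolding magic_block_def All_less_3 by simp
  then have neq: "C (1, 3) \<noteq> C (3, 1)" by (simp add: entry_def numeral_eq_Suc)
  show ?thesis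
  proof (cases "C (1, 3) < C (3, 1)")
    case True
    then have "canonical C"
      using C base_equal_twists_iff[OF C(1,2)] by (simp add: canonical_iff_base)
    with gf show ?thesis using that by blast
  next
    case False
    with neq have "canonical (act transpose_cells C)"
      using CT CT_twist base_equal_twists_iff[OF CT] act_transpose[of 1 3 C] act_transpose[of 3 1 C]
      by (simp add: canonical_iff_base)
    moreover have "act transpose_cells C = act (transpose_cells \<circ> (g \<circ> f)) B0"
      using gf Hmm_permutes transpose_Hmm by (simp only: act_comp)
    ultimately show ?thesis using that Hmm_comp[OF transpose_Hmm gf(2)] by metis
  qed
qed

section \<open>Uniqueness\<close>

text \<open>Lines count from 1, so remainder 2 marks the middle line of a strip.\<close>

lemma entry_centre_dvd:
  assumes "modular_magic B" "r \<in> {1..9}" "c \<in> {1..9}" "r mod 3 = 2" "c mod 3 = 2"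
  shows "3 dvd B (r, c)"
proof -
  from assms(2) obtain a i where r: "a < 3" "i < 3" "r = 3 * a + i + 1" by (rule line_cases)
  from assms(3) obtain b j where c: "b < 3" "j < 3" "c = 3 * b + j + 1" by (rule line_cases)
  from assms(4) r(2,3) have "i = 1" by presburger
  moreover from assms(5) c(2,3) have "j = 1" by presburger
  ultimately have "B (r, c) = entry B a b 1 1" using r c by (simp add: entry_def)
  with magic_block_shape(1)[OF entry_block[OF assms(1) r(1) c(1)]] show ?thesis by auto
qed

text \<open>
  If \<open>r\<close> were not a central line, then reversing the pillar of \<open>c\<close> would produce a modular-magic
  board whose entry at \<open>(r, c)\<close> is not a multiple of 3, and \<open>g\<close> moves that cell to the centre of a block.
\<close>

lemma centre_line_preimage:
  assumes B: "modular_magic B" and g: "g \<in> Hmm"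
    and \<sigma>: "line_perm \<sigma>" and \<tau>: "line_perm \<tau>"
    and straight: "\<And>r c. r \<in> {1..9} \<Longrightarrow> c \<in> {1..9} \<Longrightarrow> g (r, c) = (\<sigma> r, \<tau> c)"
    and r: "r \<in> {1..9}" "\<sigma> r mod 3 = 2"
  shows "r mod 3 = 2"
proof (rule ccontr)
  assume not2: "r mod 3 \<noteq> 2"
  \<comment> \<open>Any central column would do as the target; 2 is one of them.\<close>
  have "2 \<in> \<tau> ` {1..9}"
    using \<tau> by (simp add: line_perm_def bij_betw_def)
  then obtain c where c: "c \<in> {1..9}" "\<tau> c = 2" by auto
  have dvd: "3 dvd C (r, c)" if C: "modular_magic C" for C
  proof -
    have "3 dvd act g C (\<sigma> r, \<tau> c)"
      using entry_centre_dvd[OF Hmm_modular_magic[OF g C]] line_perm_mem[OF \<sigma> r(1)] r c by simp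
    then show ?thesis
      using act_apply[OF Hmm_permutes[OF g], of C "(r, c)"] straight[OF r(1) c(1)] by simp
  qed
  from r(1) obtain a i where a: "a < 3" "i < 3" "r = 3 * a + i + 1" by (rule line_cases)
  from c(1) obtain b j where b: "b < 3" "j < 3" "c = 3 * b + j + 1" by (rule line_cases)
  have i: "i = 0 \<or> i = 2" using not2 a by presburger
  have "{b} \<subseteq> {0..<3}" using b by simp
  then obtain h where h: "h \<in> Hmm" "\<And>B a b' i j. a < 3 \<Longrightarrow> b' < 3 \<Longrightarrow> i < 3 \<Longrightarrow> j < 3 \<Longrightarrow>
       entry (act h B) a b' i j = entry B a b' i (if b' \<in> {b} then 2 - j else j)"
    by (rule flip_pillars) blast
  have "3 dvd entry B a b i j" using dvd[OF B] a b by (simp add: entry_def)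
  moreover have "3 dvd entry B a b i (2 - j)"
    using dvd[OF Hmm_modular_magic[OF h(1) B]] h(2)[of a b i j B] a b by (simp add: entry_def)
  moreover note magic_block_shape(2-6)[OF entry_block[OF B a(1) b(1)]]
  moreover have "j = 0 \<or> j = 1 \<or> j = 2" using b(2) by auto
  \<comment> \<open>If \<open>j\<close> is 1, the entry itself is prime to 3. Otherwise the two
    entries are corners on different diagonals, and only one of them is a multiple of 3.\<close>
  ultimately show False using i by auto
qed

definition centre_preserving :: "(nat \<Rightarrow> nat) \<Rightarrow> bool" where
  "centre_preserving \<sigma> \<longleftrightarrow> (\<forall>r\<in>{1..9}. \<sigma> r mod 3 = 2 \<longleftrightarrow> r mod 3 = 2)"

text \<open>The preimage of the middle rows lies in the middle rows by
  \<open>centre_line_preimage\<close>, and it has at least as many elements because \<sigma> is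
  onto; so the two sets agree.\<close>

lemma centre_preserving_straight:
  assumes B: "modular_magic B" and g: "g \<in> Hmm"
    and \<sigma>: "line_perm \<sigma>" and \<tau>: "line_perm \<tau>"
    and straight: "\<And>r c. r \<in> {1..9} \<Longrightarrow> c \<in> {1..9} \<Longrightarrow> g (r, c) = (\<sigma> r, \<tau> c)"
  shows "centre_preserving \<sigma>"
proof -
  let ?M = "{r \<in> {1..9::nat}. r mod 3 = 2}" and ?P = "{r \<in> {1..9}. \<sigma> r mod 3 = 2}"
  have "?P \<subseteq> ?M" using centre_line_preimage[OF assms] by blast
  moreover have "?M \<subseteq> \<sigma> ` ?P"
  proof
    fix s assume s: "s \<in> ?M"
    then have "s \<in> \<sigma> ` {1..9}" using \<sigma> by (simp add: line_perm_def bij_betw_def)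
    with s show "s \<in> \<sigma> ` ?P" by auto
  qed
  then have "card ?M \<le> card ?P" by (rule surj_card_le[rotated]) simp
  ultimately have "?P = ?M" by (intro card_seteq) simp_all
  then show ?thesis unfolding centre_preserving_def by blast
qed

text \<open>Only the rows are asked to keep middle lines; between boards in standard form the
  diagonals transfer this to the columns.\<close>

definition straight :: "(nat \<times> nat \<Rightarrow> nat \<times> nat) \<Rightarrow> bool" where
  "straight g \<longleftrightarrow> (\<exists>\<sigma> \<tau>. line_perm \<sigma> \<and> line_perm \<tau> \<and> centre_preserving \<sigma> \<and>
     (\<forall>r\<in>{1..9}. \<forall>c\<in>{1..9}. g (r, c) = (\<sigma> r, \<tau> c)))"

text \<open>If \<open>g\<close> exchanges rows and columns, composing it with the transpose makes it
  straight.\<close>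

lemma Hmm_straight:
  assumes B: "modular_magic B" and g: "g \<in> Hmm"
  obtains h where "h \<in> Hmm" "straight h" "act g B = act h B \<or> act g B = act transpose_cells (act h B)"
proof -
  have "g \<in> H9" using g by (simp add: Hmm_def)
  then obtain \<sigma> \<tau> where st: "line_perm \<sigma>" "line_perm \<tau>"
    and form: "(\<forall>r\<in>{1..9}. \<forall>c\<in>{1..9}. g (r, c) = (\<sigma> r, \<tau> c)) \<or>
       (\<forall>r\<in>{1..9}. \<forall>c\<in>{1..9}. g (r, c) = (\<tau> c, \<sigma> r))" by (rule H9_form)
  from form show ?thesis
  proof
    assume *: "\<forall>r\<in>{1..9}. \<forall>c\<in>{1..9}. g (r, c) = (\<sigma> r, \<tau> c)"
    then have "straight g"
      unfolding straight_def using centre_preserving_straight[OF B g st] st by blast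
    with g show ?thesis using that by blast
  next
    assume *: "\<forall>r\<in>{1..9}. \<forall>c\<in>{1..9}. g (r, c) = (\<tau> c, \<sigma> r)"
    let ?h = "transpose_cells \<circ> g"
    have h: "?h \<in> Hmm" by (intro Hmm_comp g transpose_Hmm)
    have hf: "?h (r, c) = (\<sigma> r, \<tau> c)" if "r \<in> {1..9}" "c \<in> {1..9}" for r c
      using * that line_perm_mem[OF st(1) that(1)] line_perm_mem[OF st(2) that(2)]
      by (simp add: transpose_cells_def cells_def)
    then have "straight ?h"
      unfolding straight_def using centre_preserving_straight[OF B h st] st by blast
    moreover have "act g B = act transpose_cells (act ?h B)"
      by (simp only: act_comp transpose_cells_permutes Hmm_permutes[OF g] transpose_transpose)
    ultimately show ?thesis using that[OF h] by blast
  qed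
qed

text \<open>The blocks (0,0), (1,2), (2,1) meet every band and every pillar. So each block shares
  $t^2$ with one of them and $(t+3)^2$ with one of them, and the two squares determine the
  twist.\<close>

lemma constant_twists:
  assumes B: "modular_magic B" "base B"
    and eq: "twist B 1 2 = twist B 0 0" "twist B 2 1 = twist B 0 0"
    and ab: "a < 3" "b < 3"
  shows "twist B a b = twist B 0 0"
proof -
  note T = Hmm_modular_magic[OF transpose_Hmm B(1)] base_transpose[OF B(2)]
  have "a = 0 \<or> a = 1 \<or> a = 2" "b = 0 \<or> b = 1 \<or> b = 2" using ab by auto
  \<comment> \<open>\<open>(3 - a) mod 3\<close> is the pillar in which band \<open>a\<close> has
    its block with corner 0.\<close>
  then have "twist B a ((3 - a) mod 3) = twist B 0 0" "twist B ((3 - b) mod 3) b = twist B 0 0"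
    using eq by auto
  then obtain a' b' where a': "a' < 3" "twist B a' b = twist B 0 0"
    and b': "b' < 3" "twist B a b' = twist B 0 0"
    by (metis mod_less_divisor zero_less_numeral)
  show ?thesis
  proof (rule twist_inject[OF twist_cases[OF B ab] twist_cases[OF B, of 0 0]])
    show "(twist B a b)^2 mod 9 = (twist B 0 0)^2 mod 9"
      using twist_band[OF B ab b'(1)] b'(2) by simp
    have "(twist (act transpose_cells B) b a)^2 mod 9 = (twist (act transpose_cells B) b a')^2 mod 9"
      by (rule twist_band[OF T ab(2,1) a'(1)])
    then show "((15 - twist B a b) mod 9)^2 mod 9 = ((15 - twist B 0 0) mod 9)^2 mod 9"
      by (simp only: twist_transpose B ab a')
  qed simp_all
qed

section \<open>Straight rearrangements between boards in standard form\<close>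

lemma base_dvd_diagonal:
  assumes "modular_magic B" "base B" "a < 3" "b < 3" "i < 3" "j < 3" "3 dvd entry B a b i j"
  shows "i = j"
proof -
  note shape = magic_block_shape[OF entry_block[OF assms(1,3,4)]]
  have "3 dvd entry B a b 0 0" using entry_base[OF assms(2-4), of 0] by simp
  then have "\<not> 3 dvd entry B a b 0 2" "\<not> 3 dvd entry B a b 2 0" using shape(6) by blast+
  moreover have "i = 0 \<or> i = 1 \<or> i = 2" "j = 0 \<or> j = 1 \<or> j = 2" using assms(5,6) by auto
  ultimately show ?thesis using shape(2-5) assms(7) by (elim disjE) simp_all
qed

lemma line_perm_coordinates:
  assumes "line_perm \<sigma>"
  obtains \<pi> \<phi> where "\<And>a. a < 3 \<Longrightarrow> \<pi> a < (3::nat)" "\<And>a i. a < 3 \<Longrightarrow> i < 3 \<Longrightarrow> \<phi> a i < (3::nat)"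
    "\<And>a i. a < 3 \<Longrightarrow> i < 3 \<Longrightarrow> \<sigma> (3 * a + i + 1) = 3 * \<pi> a + \<phi> a i + 1"
proof
  define \<pi> where "\<pi> a = (\<sigma> (3 * a + 0 + 1) - 1) div 3" for a
  define \<phi> where "\<phi> a i = (\<sigma> (3 * a + i + 1) - 1) mod 3" for a i
  have mem: "\<sigma> (3 * a + i + 1) \<in> {1..9}" if "a < 3" "i < 3" for a i
    by (intro line_perm_mem[OF assms] line_mem that)
  show "\<pi> a < 3" if "a < 3" for a using mem[OF that, of 0] by (simp add: \<pi>_def) linarith
  show "\<phi> a i < 3" for a i by (simp add: \<phi>_def)
  show "\<sigma> (3 * a + i + 1) = 3 * \<pi> a + \<phi> a i + 1" if ai: "a < 3" "i < 3" for a i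
  proof -
    have "(\<sigma> (3 * a + i + 1) - 1) div 3 = \<pi> a"
      using assms line_mem[OF ai] line_mem[OF ai(1), of 0] ai unfolding line_perm_def \<pi>_def by simp
    then have "\<sigma> (3 * a + i + 1) - 1 = 3 * \<pi> a + \<phi> a i"
      unfolding \<phi>_def by (metis mult_div_mod_eq)
    moreover have "\<sigma> (3 * a + i + 1) \<ge> 1" using mem[OF ai] by simp
    ultimately show ?thesis by linarith
  qed
qed

text \<open>\<open>l\<close> represents $-k$ modulo 3, so the first congruence is solved for
  \<open>r\<close> without subtraction.\<close>

lemma mod_3_solve:
  fixes k l r b :: nat
  assumes "(r + k) mod 3 = b mod 3" "(k + l) mod 3 = 0" "r < 3"
  shows "r = (b + l) mod 3"
proof -
  have "(b + l) mod 3 = (r + k + l) mod 3"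
    using assms(1) by (metis mod_add_left_eq)
  also have "\<dots> = (r + (k + l) mod 3) mod 3" by (simp add: mod_simps add.assoc)
  finally show ?thesis using assms(2,3) by simp
qed

text \<open>The diagonals carry the multiples of 3, so positions within bands and within pillars
  move alike. With the centres fixed, the diagonal values become conditions on band and pillar
  indices, which leave only opposite shifts by some \<open>k\<close>.\<close>

lemma straight_base_unique:
  assumes B: "modular_magic B" "base B" "twist B 1 2 = twist B 2 1"
    and C: "modular_magic C" "base C" "twist C 1 2 = twist C 2 1"
    and \<sigma>: "line_perm \<sigma>" "centre_preserving \<sigma>" and \<tau>: "line_perm \<tau>"
    and eq: "\<And>r c. r \<in> {1..9} \<Longrightarrow> c \<in> {1..9} \<Longrightarrow> C (\<sigma> r, \<tau> c) = B (r, c)"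
  shows "B = C"
proof -
  obtain \<pi> \<phi> where \<pi>: "\<And>a. a < 3 \<Longrightarrow> \<pi> a < (3::nat)" and \<phi>: "\<And>a i. a < 3 \<Longrightarrow> i < 3 \<Longrightarrow> \<phi> a i < (3::nat)"
    and \<sigma>_eq: "\<And>a i. a < 3 \<Longrightarrow> i < 3 \<Longrightarrow> \<sigma> (3 * a + i + 1) = 3 * \<pi> a + \<phi> a i + 1"
    using line_perm_coordinates[OF \<sigma>(1)] by blast
  obtain \<rho> \<psi> where \<rho>: "\<And>a. a < 3 \<Longrightarrow> \<rho> a < (3::nat)" and \<psi>: "\<And>a i. a < 3 \<Longrightarrow> i < 3 \<Longrightarrow> \<psi> a i < (3::nat)"
    and \<tau>_eq: "\<And>a i. a < 3 \<Longrightarrow> i < 3 \<Longrightarrow> \<tau> (3 * a + i + 1) = 3 * \<rho> a + \<psi> a i + 1"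
    using line_perm_coordinates[OF \<tau>] by blast
  have ent: "entry C (\<pi> a) (\<rho> b) (\<phi> a i) (\<psi> b j) = entry B a b i j"
    if "a < 3" "b < 3" "i < 3" "j < 3" for a b i j
    using eq[OF line_mem[OF that(1,3)] line_mem[OF that(2,4)]] that
    unfolding entry_def by (simp only: \<sigma>_eq \<tau>_eq)
  have diag: "\<phi> a i = \<psi> b i" if "a < 3" "b < 3" "i < 3" for a b i
  proof (rule base_dvd_diagonal[OF C(1,2)])
    show "3 dvd entry C (\<pi> a) (\<rho> b) (\<phi> a i) (\<psi> b i)"
      unfolding ent[OF that(1,2,3,3)] using entry_base[OF B(2) that] by simp
  qed (use that \<pi> \<rho> \<phi> \<psi> in simp_all)
  have sum: "(\<pi> a + \<rho> b + \<phi> a i) mod 3 = (a + b + i) mod 3" if "a < 3" "b < 3" "i < 3" for a b i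
  proof -
    have "entry C (\<pi> a) (\<rho> b) (\<phi> a i) (\<phi> a i) = entry B a b i i"
      using ent[OF that(1,2,3,3)] diag[OF that] by simp
    then show ?thesis
      unfolding entry_base[OF B(2) that]
        entry_base[OF C(2) \<pi>[OF that(1)] \<rho>[OF that(2)] \<phi>[OF that(1,3)]] by simp
  qed
  have one: "1 < (3::nat)" by simp
  have \<phi>_1: "\<phi> a 1 = 1" if "a < 3" for a
  proof -
    have "(3 * a + 1 + 1) mod 3 = 2" by presburger
    then have "\<sigma> (3 * a + 1 + 1) mod 3 = 2"
      using \<sigma>(2) line_mem[OF that, of 1] unfolding centre_preserving_def by simp
    then have "(3 * \<pi> a + \<phi> a 1 + 1) mod 3 = 2" using \<sigma>_eq[OF that, of 1] by simp
    moreover have "\<phi> a 1 = 0 \<or> \<phi> a 1 = 1 \<or> \<phi> a 1 = 2" using \<phi>[OF that, of 1] by auto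
    ultimately show ?thesis by (elim disjE) simp_all
  qed
  have sum1: "(\<pi> a + \<rho> b) mod 3 = (a + b) mod 3" if "a < 3" "b < 3" for a b
    using sum[OF that one] unfolding \<phi>_1[OF that(1)] by (rule mod_add_cancel)
  \<comment> \<open>The centres have settled the sum of band and pillar index, so the remaining
    diagonal values force each position to itself.\<close>
  have \<phi>_eq: "\<phi> a i = i" if "a < 3" "i < 3" for a i
  proof -
    have "(\<pi> a + \<rho> 0) mod 3 = a mod 3" "(\<pi> a + \<rho> 0 + \<phi> a i) mod 3 = (a + i) mod 3"
      using sum1[OF that(1), of 0] sum[OF that(1) _ that(2), of 0] by simp_all
    then have "(\<phi> a i + a) mod 3 = (i + a) mod 3"
      by (metis add.commute mod_add_left_eq)
    then have "\<phi> a i mod 3 = i mod 3" by (rule mod_add_cancel)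
    with that \<phi>[OF that] show ?thesis by simp
  qed
  define k where "k = \<pi> 0"
  have k: "k < 3" using \<pi> by (simp add: k_def)
  have \<rho>_eq: "\<rho> b = (b + 2 * k) mod 3" if "b < 3" for b
    by (rule mod_3_solve[of _ k]) (use sum1[of 0 b] that \<rho> in \<open>simp_all add: k_def add.commute\<close>)
  have \<pi>_eq: "\<pi> a = (a + k) mod 3" if "a < 3" for a
  proof (rule mod_3_solve)
    show "(\<pi> a + \<rho> 0) mod 3 = a mod 3" using sum1[of a 0] that by simp
    show "(\<rho> 0 + k) mod 3 = 0" using sum1[of 0 0] by (simp add: k_def add.commute)
  qed (use that \<pi> in simp)
  have twist_eq: "twist C ((a + k) mod 3) ((b + 2 * k) mod 3) = twist B a b" if "a < 3" "b < 3" for a b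
    using ent[OF that, of 0 2] ent[OF that, of 0 0] diag[OF that, of 2] diag[OF that, of 0] that
    by (simp add: twist_def \<phi>_eq \<pi>_eq \<rho>_eq)
  show ?thesis
  proof (cases "k = 0")
    case True
    show ?thesis
      by (rule twist_determines[OF B(1,2) C(1,2)]) (use twist_eq True in simp)
  next
    case False
    with k have "k = 1 \<or> k = 2" by auto
    \<comment> \<open>A nonzero shift permutes the blocks with corner 0 cyclically. Together with
      the equal pair in \<open>B\<close> and the one in \<open>C\<close>, all six twists
      coincide.\<close>
    then have "twist B 1 2 = twist B 0 0 \<and> twist B 2 1 = twist B 0 0 \<and>
        twist C 1 2 = twist B 0 0 \<and> twist C 2 1 = twist B 0 0 \<and> twist C 0 0 = twist B 0 0"
      using twist_eq[of 0 0] twist_eq[of 1 2] twist_eq[of 2 1] B(3) C(3)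
      by (auto simp: numeral_2_eq_2)
    then show ?thesis
      by (intro twist_determines[OF B(1,2) C(1,2)])
        (metis constant_twists[OF B(1,2)] constant_twists[OF C(1,2)])
  qed
qed
text \<open>Both elements are first made straight at the cost of a transpose. The straight images
  agree, and the inequality in \<open>canonical\<close> decides between a board and its
  transpose.\<close>

lemma canonical_unique:
  assumes B0: "modular_magic B0"
    and f: "f \<in> Hmm" "canonical (act f B0)" and g: "g \<in> Hmm" "canonical (act g B0)"
  shows "act f B0 = act g B0"
proof -
  let ?T = "act transpose_cells"
  have *: "\<exists>h\<in>Hmm. straight h \<and> base (act h B0) \<and> twist (act h B0) 1 2 = twist (act h B0) 2 1 \<and>
      (act g B0 = act h B0 \<or> act g B0 = ?T (act h B0))"
    if g: "g \<in> Hmm" "canonical (act g B0)" for g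
  proof -
    let ?B = "act g B0"
    have B: "modular_magic ?B" "base ?B"
      using Hmm_modular_magic[OF g(1) B0] g(2) by (simp_all add: canonical_iff_base)
    then have tw: "twist ?B 1 2 = twist ?B 2 1"
      using base_equal_twists_iff g(2) by (simp add: canonical_iff_base)
    then have "twist (?T ?B) 1 2 = twist (?T ?B) 2 1"
      using B by (simp add: twist_transpose)
    moreover obtain h where h: "h \<in> Hmm" "straight h" "?B = act h B0 \<or> ?B = ?T (act h B0)"
      using Hmm_straight[OF B0 g(1)] by blast
    \<comment> \<open>\<open>base\<close> and the equality of twists survive the transpose, so they
      pass to the straight image even where the inequality does not.\<close>
    moreover have "act h B0 = ?B \<or> act h B0 = ?T ?B"
      using h(3) transpose_transpose by metis
    ultimately show ?thesis using B(2) tw base_transpose by metis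
  qed
  from *[OF f] obtain f' where f': "f' \<in> Hmm" "straight f'" "base (act f' B0)"
    "twist (act f' B0) 1 2 = twist (act f' B0) 2 1" "act f B0 = act f' B0 \<or> act f B0 = ?T (act f' B0)"
    by blast
  from *[OF g] obtain g' where g': "g' \<in> Hmm" "straight g'" "base (act g' B0)"
    "twist (act g' B0) 1 2 = twist (act g' B0) 2 1" "act g B0 = act g' B0 \<or> act g B0 = ?T (act g' B0)"
    by blast
  from f'(2) obtain \<sigma> \<tau> where st: "line_perm \<sigma>" "line_perm \<tau>" "centre_preserving \<sigma>"
    and f'_eq: "\<And>r c. r \<in> {1..9} \<Longrightarrow> c \<in> {1..9} \<Longrightarrow> f' (r, c) = (\<sigma> r, \<tau> c)"
    unfolding straight_def by blast
  from g'(2) obtain \<sigma>' \<tau>' where st': "line_perm \<sigma>'" "line_perm \<tau>'" "centre_preserving \<sigma>'"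
    and g'_eq: "\<And>r c. r \<in> {1..9} \<Longrightarrow> c \<in> {1..9} \<Longrightarrow> g' (r, c) = (\<sigma>' r, \<tau>' c)"
    unfolding straight_def by blast
  \<comment> \<open>Inverting on the lines describes the passage from the image under
    \<open>f'\<close> to the image under \<open>g'\<close> by row and column maps.\<close>
  let ?i = "inv_into {1..9} \<sigma>" and ?j = "inv_into {1..9} \<tau>"
  have ij: "?i r \<in> {1..9}" "?j r \<in> {1..9}" "\<sigma> (?i r) = r" "\<tau> (?j r) = r" if "r \<in> {1..9}" for r
    using that line_perm_mem[OF line_perm_inv_into] st
    by (auto simp: line_perm_def bij_betw_inv_into_right simp del: atLeastAtMost_iff)
  have "act f' B0 = act g' B0"
  proof (rule straight_base_unique)
    show "modular_magic (act f' B0)" "modular_magic (act g' B0)"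
      using f'(1) g'(1) B0 by (simp_all add: Hmm_modular_magic)
    show "line_perm (\<sigma>' \<circ> ?i)" "line_perm (\<tau>' \<circ> ?j)"
      by (intro line_perm_comp line_perm_inv_into st st')+
    show "centre_preserving (\<sigma>' \<circ> ?i)"
      using ij st(3) st'(3) unfolding centre_preserving_def comp_apply by metis
    show "act g' B0 ((\<sigma>' \<circ> ?i) r, (\<tau>' \<circ> ?j) c) = act f' B0 (r, c)"
      if rc: "r \<in> {1..9}" "c \<in> {1..9}" for r c
    proof -
      have "act f' B0 (r, c) = B0 (?i r, ?j c)"
        using act_apply[OF Hmm_permutes[OF f'(1)], of B0 "(?i r, ?j c)"]
        by (simp only: f'_eq ij rc)
      moreover have "act g' B0 (\<sigma>' (?i r), \<tau>' (?j c)) = B0 (?i r, ?j c)"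
        using act_apply[OF Hmm_permutes[OF g'(1)], of B0 "(?i r, ?j c)"]
        by (simp only: g'_eq ij rc)
      ultimately show ?thesis by (simp only: comp_apply)
    qed
  qed (use f' g' in simp_all)
  moreover have "?T B (1, 3) = B (3, 1)" "?T B (3, 1) = B (1, 3)" for B
    by (simp_all add: act_transpose)
  ultimately show ?thesis
    using f(2) g(2) f'(5) g'(5) unfolding canonical_iff_base by (metis less_asym)
qed

theorem theorem2p2:
  assumes "modular_magic B0"
  shows "\<exists>!B. B \<in> nest B0 \<and> modular_magic B \<and> canonical B"
proof -
  obtain g where "g \<in> Hmm" "canonical (act g B0)" by (rule exists_canonical[OF assms])
  then show ?thesis
    using canonical_unique[OF assms] Hmm_modular_magic[OF _ assms] unfolding nest_def by blast
qed

end
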